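(* Let $d,a_1,\dots,a_n,b_1,\dots,b_n,c$ be positive integers with $d\mid q-1$, let $\lambda_1,\dots,\lambda_n\in\kappa^\times$, and let $S_{B,\lambda}$ be the $n$-dimensional affine hypersurface over $\kappa$ defined by $$y^d=\Big(\prod_{i=1}^n(1-\lambda_ix_i)^{a_i}\Big)\Big(\prod_{i=1}^nx_i^{b_i}\Big)\Big(1-\sum_{i=1}^nx_i\Big)^c,$$ with $\mu_d$ acting by $\xi\cdot(x_1,\dots,x_n,y)=(x_1,\dots,x_n,\xi y)$. Suppose that $\gcd(d,a_i)=\gcd(d,c)=1$ for all $i$. Then, for $m\in\mathbb{Z}/d\mathbb{Z}$, $$N_1(S_{B,\lambda};\chi^m)=\begin{cases}q^n&(m=0),\\ (-1)^nJ_B\cdot F_B^{(n)}\left({\overline{\varphi_d}^{ma_1},\dots,\overline{\varphi_d}^{ma_n};\varphi_d^{mb_1},\dots,\varphi_d^{mb_n}\atop\varphi_d^{m(b_1+\cdots+b_n+c)}};\lambda_1,\dots,\lambda_n\right)&(m\neq0),\end{cases}$$ where $J_B=j\big(\varphi_d^{mb_1},\dots,\varphi_d^{mb_n},\varphi_d^{mc}\big)$.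
   Context: $\kappa$ is a finite field with $q$ elements of characteristic $p$. $\widehat{\kappa^\times}=\mathrm{Hom}(\kappa^\times,\overline{\mathbb{Q}}^\times)$ is the group of multiplicative characters, $\varepsilon$ the trivial character, $\overline{\eta}=\eta^{-1}$; every $\eta\in\widehat{\kappa^\times}$ (including $\varepsilon$) is extended to $\kappa$ by $\eta(0)=0$. $\delta(\eta)=1$ if $\eta=\varepsilon$ and $0$ otherwise. Fix a non-trivial additive character $\psi\in\mathrm{Hom}(\kappa,\overline{\mathbb{Q}}^\times)$. Put $$g(\eta)=-\sum_{x\in\kappa^\times}\psi(x)\eta(x),\quad g^\circ(\eta)=q^{\delta(\eta)}g(\eta),\quad j(\eta_1,\dots,\eta_k)=(-1)^{k-1}\sum_{x_i\in\kappa^\times,\ x_1+\cdots+x_k=1}\ \prod_{i=1}^k\eta_i(x_i)\ (k\ge 2),$$ $$(\alpha)_\nu=\frac{g(\alpha\nu)}{g(\alpha)},\qquad(\alpha)_\nu^\circ=\frac{g^\circ(\alpha\nu)}{g^\circ(\alpha)},$$ $$F_B^{(n)}\left({\alpha_1,\dots,\alpha_n;\beta_1,\dots,\beta_n\atop\gamma};\lambda_1,\dots,\lambda_n\right)=\frac{1}{(1-q)^n}\sum_{\nu_1,\dots,\nu_n\in\widehat{\kappa^\times}}\frac{(\alpha_1)_{\nu_1}\cdots(\alpha_n)_{\nu_n}(\beta_1)_{\nu_1}\cdots(\beta_n)_{\nu_n}}{(\gamma)^\circ_{\nu_1\cdots\nu_n}(\varepsilon)^\circ_{\nu_1}\cdots(\varepsilon)^\circ_{\nu_n}}\nu_1(\lambda_1)\cdots\nu_n(\lambda_n).$$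 $\mu_d\subset\kappa^\times$ is the group of $d$th roots of unity. Fix a generator $\varphi$ of $\widehat{\kappa^\times}$ and put $\varphi_d=\varphi^{(q-1)/d}$, $\chi=\varphi|_{\mu_d}$, so that $\widehat{\mu_d}=\{\chi^m\mid m\in\mathbb{Z}/d\mathbb{Z}\}$. For a variety $V$ over $\kappa$ with an action over $\kappa$ of a finite abelian group $G$, with $F$ the $q$-Frobenius on $V(\overline{\kappa})$, and for $\theta\in\mathrm{Hom}(G,\overline{\mathbb{Q}}^\times)$ and $r\ge1$, $$N_r(V;\theta)=\frac{1}{\#G}\sum_{g\in G}\theta(g)\,\#\{x\in V(\overline{\kappa})\mid F^r(x)=g(x)\}.$$ *)

theory Defs
  imports "HOL-Algebra.Algebraic_Closure_Type" "HOL-Algebra.Generated_Groups"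
    "HOL-Library.Cardinality"
begin

type_synonym qbar = "rat alg_closure"

text \<open>The finite field is the type \<open>'k\<close>, with \<open>CARD('k)\<close> elements; families indexed by
  \<open>1, \<dots>, n\<close> are functions on a finite type \<open>'n\<close>.\<close>


section \<open>Characters\<close>

text \<open>A multiplicative character is represented by its extension to the whole field with value
  \<open>0\<close> at \<open>0\<close>.\<close>

definition mult_chars :: "('k :: {field,finite} \<Rightarrow> qbar) set" where
  "mult_chars = {\<eta>. \<eta> 0 = 0 \<and> (\<forall>x. x \<noteq> 0 \<longrightarrow> \<eta> x \<noteq> 0) \<and>
     (\<forall>x y. x \<noteq> 0 \<longrightarrow> y \<noteq> 0 \<longrightarrow> \<eta> (x * y) = \<eta> x * \<eta> y)}"

definition triv_char :: "'k :: {field,finite} \<Rightarrow> qbar" where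
  "triv_char x = (if x = 0 then 0 else 1)"

definition char_group :: "('k :: {field,finite} \<Rightarrow> qbar) monoid" where
  "char_group = \<lparr>carrier = mult_chars, monoid.mult = (\<lambda>\<eta> \<theta> x. \<eta> x * \<theta> x), monoid.one = triv_char\<rparr>"

lemma comm_group_char_group: "comm_group (char_group :: ('k :: {field,finite} \<Rightarrow> qbar) monoid)"
proof (rule comm_groupI)
  fix \<eta> :: "'k \<Rightarrow> qbar"
  assume \<eta>: "\<eta> \<in> carrier char_group"
  have "\<eta> (1 * 1) = \<eta> 1 * \<eta> 1" "\<eta> 1 \<noteq> 0"
    using \<eta> one_neq_zero unfolding char_group_def mult_chars_def by (auto simp del: mult_1_left mult_1_right)
  show "\<one>\<^bsub>char_group\<^esub> \<otimes>\<^bsub>char_group\<^esub> \<eta> = \<eta>"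
    using \<eta> by (auto simp: char_group_def mult_chars_def triv_char_def)
  show "\<exists>\<theta>\<in>carrier char_group. \<theta> \<otimes>\<^bsub>char_group\<^esub> \<eta> = \<one>\<^bsub>char_group\<^esub>"
    by (rule bexI[of _ "\<lambda>x. inverse (\<eta> x)"])
      (use \<eta> in \<open>auto simp: char_group_def mult_chars_def triv_char_def field_simps\<close>)
qed (auto simp: char_group_def mult_chars_def triv_char_def algebra_simps)

definition nontriv_add_char :: "('k :: {field,finite} \<Rightarrow> qbar) \<Rightarrow> bool" where
  "nontriv_add_char \<psi> \<longleftrightarrow> (\<forall>x. \<psi> x \<noteq> 0) \<and> (\<forall>x y. \<psi> (x + y) = \<psi> x * \<psi> y) \<and> (\<exists>x. \<psi> x \<noteq> 1)"


section \<open>Gauss and Jacobi sums\<close>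

definition gauss_sum :: "('k :: {field,finite} \<Rightarrow> qbar) \<Rightarrow> ('k \<Rightarrow> qbar) \<Rightarrow> qbar" where
  "gauss_sum \<psi> \<eta> = - (\<Sum>x\<in>UNIV - {0}. \<psi> x * \<eta> x)"

definition gauss_sum_circ :: "('k :: {field,finite} \<Rightarrow> qbar) \<Rightarrow> ('k \<Rightarrow> qbar) \<Rightarrow> qbar" where
  "gauss_sum_circ \<psi> \<eta> = of_nat CARD('k) ^ (if \<eta> = triv_char then 1 else 0) * gauss_sum \<psi> \<eta>"

definition jacobi_sum :: "('i :: finite \<Rightarrow> 'k :: {field,finite} \<Rightarrow> qbar) \<Rightarrow> qbar" where
  "jacobi_sum \<eta> = (-1) ^ (CARD('i) - 1) *
     (\<Sum>x | (\<forall>i. x i \<noteq> 0) \<and> (\<Sum>i\<in>UNIV. x i) = 1. \<Prod>i\<in>UNIV. \<eta> i (x i))"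

definition poch ::
    "('k :: {field,finite} \<Rightarrow> qbar) \<Rightarrow> ('k \<Rightarrow> qbar) \<Rightarrow> ('k \<Rightarrow> qbar) \<Rightarrow> qbar" where
  "poch \<psi> \<alpha> \<nu> = gauss_sum \<psi> (\<alpha> \<otimes>\<^bsub>char_group\<^esub> \<nu>) / gauss_sum \<psi> \<alpha>"

definition poch_circ ::
    "('k :: {field,finite} \<Rightarrow> qbar) \<Rightarrow> ('k \<Rightarrow> qbar) \<Rightarrow> ('k \<Rightarrow> qbar) \<Rightarrow> qbar" where
  "poch_circ \<psi> \<alpha> \<nu> = gauss_sum_circ \<psi> (\<alpha> \<otimes>\<^bsub>char_group\<^esub> \<nu>) / gauss_sum_circ \<psi> \<alpha>"


section \<open>The Lauricella function of type B\<close>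

definition lauricella_B ::
    "('k :: {field,finite} \<Rightarrow> qbar) \<Rightarrow> ('n :: finite \<Rightarrow> 'k \<Rightarrow> qbar) \<Rightarrow> ('n \<Rightarrow> 'k \<Rightarrow> qbar) \<Rightarrow>
     ('k \<Rightarrow> qbar) \<Rightarrow> ('n \<Rightarrow> 'k) \<Rightarrow> qbar" where
  "lauricella_B \<psi> \<alpha> \<beta> \<gamma> l =
     1 / (1 - of_nat CARD('k)) ^ CARD('n) *
     (\<Sum>\<nu> | \<forall>i. \<nu> i \<in> carrier char_group.
        ((\<Prod>i\<in>UNIV. poch \<psi> (\<alpha> i) (\<nu> i)) * (\<Prod>i\<in>UNIV. poch \<psi> (\<beta> i) (\<nu> i))) /
        (poch_circ \<psi> \<gamma> (\<Otimes>\<^bsub>char_group\<^esub>i\<in>UNIV. \<nu> i) *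
           (\<Prod>i\<in>UNIV. poch_circ \<psi> \<one>\<^bsub>char_group\<^esub> (\<nu> i))) *
        (\<Prod>i\<in>UNIV. \<nu> i (l i)))"


section \<open>Counting points\<close>

text \<open>Varieties are given by their geometric points in an affine space whose coordinates are
  indexed by \<open>'i\<close>.\<close>

definition frobenius :: "('i \<Rightarrow> 'k :: {field,finite} alg_closure) \<Rightarrow> 'i \<Rightarrow> 'k alg_closure" where
  "frobenius x = (\<lambda>i. x i ^ CARD('k))"

definition twisted_count ::
    "'g set \<Rightarrow> ('g \<Rightarrow> ('i \<Rightarrow> 'k :: {field,finite} alg_closure) \<Rightarrow> 'i \<Rightarrow> 'k alg_closure) \<Rightarrow> nat \<Rightarrow>
     ('i \<Rightarrow> 'k alg_closure) set \<Rightarrow> ('g \<Rightarrow> qbar) \<Rightarrow> qbar" where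
  "twisted_count G act r V \<theta> =
     1 / of_nat (card G) *
     (\<Sum>g\<in>G. \<theta> g * of_nat (card {x \<in> V. (frobenius ^^ r) x = act g x}))"

definition mu :: "nat \<Rightarrow> 'k :: {field,finite} set" where
  "mu d = {\<xi>. \<xi> \<noteq> 0 \<and> \<xi> ^ d = 1}"

text \<open>The coordinates are indexed by \<open>'n option\<close>: \<open>Some i\<close> is the index of \<open>x\<^sub>i\<close>, and \<open>None\<close>
  that of \<open>y\<close>.\<close>

definition S_B ::
    "nat \<Rightarrow> ('n :: finite \<Rightarrow> nat) \<Rightarrow> ('n \<Rightarrow> nat) \<Rightarrow> nat \<Rightarrow> ('n \<Rightarrow> 'k :: {field,finite}) \<Rightarrow>
     ('n option \<Rightarrow> 'k alg_closure) set" where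
  "S_B d a b c l =
     {z. let x = (\<lambda>i. z (Some i)); y = z None in
        y ^ d = (\<Prod>i\<in>UNIV. (1 - to_ac (l i) * x i) ^ a i) * (\<Prod>i\<in>UNIV. x i ^ b i) *
          (1 - (\<Sum>i\<in>UNIV. x i)) ^ c}"

definition mu_act :: "'k :: {field,finite} \<Rightarrow> ('n option \<Rightarrow> 'k alg_closure) \<Rightarrow>
    'n option \<Rightarrow> 'k alg_closure" where
  "mu_act \<xi> z = z(None := to_ac \<xi> * z None)"

end

theory Submission
  imports Defs
begin

text \<open>
  For \<open>x \<in> \<kappa>\<^sup>n\<close> let \<open>w(x)\<close> be the right-hand side of the equation \<open>y\<^sup>d = w(x)\<close>. A
  point \<open>z = (x, y)\<close> of the hypersurface satisfies \<open>F z = \<xi> z\<close> iff \<open>x\<close> is rational and \<open>y\<^sup>q = \<xi> y\<close>. If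
  \<open>w(x) \<noteq> 0\<close>, there are \<open>d\<close> such \<open>y\<close> for \<open>\<xi> = w(x)\<^bsup>(q-1)/d\<^esup>\<close> and none for the other \<open>\<xi>\<close>; if
  \<open>w(x) = 0\<close>, then \<open>y = 0\<close> is the only one for every \<open>\<xi>\<close>. Averaging against \<open>\<chi>\<^sup>m\<close> gives \<open>q\<^sup>n\<close> if \<open>d\<close>
  divides \<open>m\<close>, and the character sum \<open>\<Sum>\<^sub>x \<phi>\<^sub>d\<^sup>m(w(x))\<close> otherwise
  (\<open>twisted_count_char_sum\<close>).

  This character sum is the finite field analogue of the Euler integral of \<open>F\<^sub>B\<close>
  (\<open>lauricella_B_integral_representation\<close>). The factors at \<open>1 - \<lambda>\<^sub>i x\<^sub>i\<close> are expanded over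
  all characters \<open>\<nu>\<^sub>i\<close> by a binomial theorem (\<open>binomial_theorem_mult_char\<close>). For fixed \<open>\<nu>\<close> what is
  left is the Jacobi sum of \<open>\<beta>\<^sub>1 \<nu>\<^sub>1, \<dots>, \<beta>\<^sub>n \<nu>\<^sub>n, \<phi>\<^sub>d\<^bsup>mc\<^esup>\<close>. Writing Jacobi sums in terms of Gauss sums
  (\<open>jacobi_sum_gauss_sum\<close>) splits off \<open>J\<^sub>B\<close> and leaves the remaining Pochhammer symbols of
  the summand of \<open>F\<^sub>B\<close>. The \<open>g\<^sup>\<circ>\<close>-normalisation absorbs the exceptional behaviour of the
  trivial character in each of these formulas, so that no case distinction on \<open>\<nu>\<close> survives.

  The two conditions on greatest common divisors enter here: the binomial theorem is used for
  the characters \<open>\<phi>\<^sub>d\<^bsup>-m a\<^sub>i\<^esup>\<close>, which have to be non-trivial, and the evaluation of the Jacobi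
  sums needs one non-trivial argument, namely \<open>\<phi>\<^sub>d\<^bsup>mc\<^esup>\<close>.

  All characters are found from \<open>\<kappa>\<^sup>\<times>\<close> being cyclic and from the \<open>q - 1\<close> roots of unity
  of order dividing \<open>q - 1\<close> in the algebraic closure of \<open>\<rat>\<close>.
\<close>

section \<open>Roots in algebraically closed fields\<close>

lemma degree_binomial:
  fixes w :: "'a :: comm_ring_1"
  assumes "n > 0"
  shows "Polynomial.degree (Polynomial.monom 1 n + [:-w:]) = n"
  using assms by (subst degree_add_eq_left) (auto simp: Polynomial.degree_monom_eq)

lemma
  fixes w :: "'a :: field"
  assumes n: "n > 0"
  shows finite_nth_roots: "finite {y. y ^ n = w}"
    and card_nth_roots_le: "card {y. y ^ n = w} \<le> n"
proof -
  let ?p = "Polynomial.monom 1 n + [:-w:]"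
  have "?p \<noteq> 0"
    using degree_binomial[OF n, of w] n by auto
  moreover have "{y. y ^ n = w} = {y. poly ?p y = 0}"
    by (simp add: poly_monom)
  ultimately show "finite {y. y ^ n = w}" "card {y. y ^ n = w} \<le> n"
    using poly_roots_finite[of ?p] card_poly_roots_bound[of ?p] degree_binomial[OF n, of w]
    by simp_all
qed

text \<open>The polynomial \<open>X\<^sup>n - w\<close> splits into \<open>n\<close> linear factors. They are distinct,
  because a repeated root would also be a root of the derivative \<open>n X\<^bsup>n-1\<^esup>\<close>, hence \<open>0\<close>,
  whereas \<open>w \<noteq> 0\<close>. This counts both the roots of unity available as character values and the
  points over a given \<open>x\<close> on the hypersurface.\<close>
lemma card_nth_roots:
  fixes w :: "'a :: alg_closed_field"
  assumes n: "of_nat n \<noteq> (0 :: 'a)" and w: "w \<noteq> 0"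
  shows "card {y. y ^ n = w} = n"
proof -
  define p where "p = Polynomial.monom (1 :: 'a) n + [:-w:]"
  have n0: "n > 0"
    using n by (cases n) auto
  have poly_p: "poly p y = y ^ n - w" for y
    by (simp add: p_def poly_monom)
  have deg: "Polynomial.degree p = n"
    unfolding p_def by (rule degree_binomial[OF n0])
  have p0: "p \<noteq> 0"
    using deg n0 by auto
  obtain A where A: "size A = n" "p = smult (Polynomial.lead_coeff p) (\<Prod>x\<in>#A. [:-x, 1:])"
    using alg_closed_imp_factorization[OF p0] deg by auto
  have count_le: "count A x \<le> 1" for x
  proof (rule ccontr)
    assume "\<not> count A x \<le> 1"
    then have "replicate_mset 2 x \<subseteq># A"
      by (simp flip: count_le_replicate_mset_subset_eq)
    then obtain B where "A = replicate_mset 2 x + B"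
      by (elim mset_subset_eq_exists_conv[THEN iffD1, elim_format] exE)
    then have B: "A = add_mset x (add_mset x B)"
      by (simp add: numeral_2_eq_2)
    define r where "r = smult (Polynomial.lead_coeff p) (\<Prod>x\<in>#B. [:-x, 1:])"
    have p: "p = [:-x, 1:] * ([:-x, 1:] * r)"
      by (subst A(2)) (simp add: B r_def algebra_simps)
    have "poly (pderiv p) x = 0" "poly p x = 0"
      unfolding p by (simp_all add: pderiv_mult del: mult_pCons_left)
    moreover have "poly (pderiv p) x = of_nat n * x ^ (n - 1)"
      by (simp add: p_def pderiv_add pderiv_monom poly_monom pderiv_pCons)
    ultimately have "x = 0" "x ^ n = w"
      using n by (auto simp: poly_p)
    then show False
      using w n0 by (simp add: zero_power)
  qed
  have set: "{y. y ^ n = w} = set_mset A"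
  proof -
    have "y ^ n = w \<longleftrightarrow> poly p y = 0" for y
      by (simp add: poly_p)
    moreover have "poly p y = 0 \<longleftrightarrow> y \<in># A" for y
      by (subst A(2)) (use p0 in \<open>auto simp: poly_prod_mset prod_mset_zero_iff\<close>)
    ultimately show ?thesis
      by auto
  qed
  have "size A = (\<Sum>x\<in>set_mset A. count A x)"
    by (simp add: size_multiset_overloaded_eq)
  also have "\<dots> = (\<Sum>x\<in>set_mset A. 1)"
    by (rule sum.cong) (use count_le in \<open>auto simp: le_Suc_eq simp flip: not_in_iff\<close>)
  finally show ?thesis
    using A(1) set by simp
qed

section \<open>Finite fields\<close>

lemma card_field_gt_1: "CARD('k :: {field,finite}) > 1"
  using card_mono[of UNIV "{0, 1 :: 'k}"] by simp

text \<open>Cyclicity of \<open>\<kappa>\<^sup>\<times>\<close>, carried over from fields with an explicit carrier to the type class.\<close>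
lemma finite_field_generator:
  obtains \<omega> :: "'k :: {field,finite}"
  where "\<omega> \<noteq> 0" "\<And>x. x \<noteq> 0 \<Longrightarrow> \<exists>i. x = \<omega> ^ i"
    "\<And>k. \<omega> ^ k = 1 \<longleftrightarrow> CARD('k) - 1 dvd k"
proof -
  define R where "R = (ring_of_type_algebra :: 'k ring)"
  interpret R: field R
    unfolding R_def by rule
  have R_simps: "carrier R = UNIV" "\<zero>\<^bsub>R\<^esub> = 0" "\<one>\<^bsub>R\<^esub> = 1" "x \<otimes>\<^bsub>R\<^esub> y = x * y" for x y
    by (simp_all add: R_def ring_of_type_algebra_def)
  have pow: "x [^]\<^bsub>R\<^esub> (i :: nat) = x ^ i" for x i
    by (induction i) (simp_all add: R_simps)
  have "\<exists>\<omega>\<in>UNIV - {0 :: 'k}. UNIV - {0} = {\<omega> ^ i |i. i \<in> (UNIV :: nat set)}"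
    using R.finite_field_mult_group_has_gen
    unfolding Multiplicative_Group.carrier_mult_of R_simps pow by simp
  then obtain \<omega> where \<omega>_in: "\<omega> \<in> UNIV - {0 :: 'k}"
      and \<omega>_gen: "UNIV - {0} = {\<omega> ^ i |i. i \<in> (UNIV :: nat set)}" ..
  have \<omega>: "\<omega> \<noteq> 0"
    using \<omega>_in by simp
  have gen: "\<exists>i. x = \<omega> ^ i" if "x \<noteq> 0" for x
    using that \<omega>_gen by blast
  interpret G: group "Multiplicative_Group.mult_of R"
    by (rule R.field_mult_group)
  have "\<omega> [^]\<^bsub>Multiplicative_Group.mult_of R\<^esub> Coset.order (Multiplicative_Group.mult_of R) =
      \<one>\<^bsub>Multiplicative_Group.mult_of R\<^esub>"
    by (rule G.pow_order_eq_1) (use \<omega> in \<open>simp_all add: R_simps\<close>)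
  then have pow_N: "\<omega> ^ (CARD('k) - 1) = 1"
    by (simp add: Multiplicative_Group.nat_pow_mult_of pow R_simps Coset.order_def
        Multiplicative_Group.carrier_mult_of Multiplicative_Group.one_mult_of card_Diff_singleton)
  have red: "\<omega> ^ k = \<omega> ^ (k mod j)" if "\<omega> ^ j = 1" for j k
    using that by (metis mod_mult_div_eq power_add power_mult power_one mult.right_neutral)
  have "CARD('k) - 1 \<le> j" if j: "j > 0" "\<omega> ^ j = 1" for j
  proof -
    \<comment> \<open>fewer than \<open>q - 1\<close> powers of \<open>\<omega>\<close> could not exhaust \<open>\<kappa>\<^sup>\<times>\<close>\<close>
    have "UNIV - {0} \<subseteq> (\<lambda>i. \<omega> ^ i) ` {..<j}"
      using gen red[OF j(2)] j(1) by (force intro: rev_image_eqI)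
    then have "card (UNIV - {0 :: 'k}) \<le> card ((\<lambda>i. \<omega> ^ i) ` {..<j})"
      by (intro card_mono) auto
    also have "\<dots> \<le> j"
      using card_image_le[of "{..<j}" "\<lambda>i. \<omega> ^ i"] by simp
    finally show ?thesis
      by (simp add: card_Diff_singleton)
  qed
  moreover have "CARD('k) - 1 > 0"
    using card_field_gt_1[where 'k = 'k] by simp
  ultimately have "CARD('k) - 1 dvd k" if "\<omega> ^ k = 1" for k
    using red[OF pow_N, of k] that
    by (metis bot_nat_0.not_eq_extremum linorder_not_less mod_greater_zero_iff_not_dvd mod_less_divisor)
  moreover have "\<omega> ^ k = 1" if "CARD('k) - 1 dvd k" for k
    using that pow_N by (auto simp: power_mult)
  ultimately show thesis
    using that[OF \<omega> gen] by blast
qed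

lemma power_card_minus_1:
  fixes x :: "'k :: {field,finite}"
  assumes "x \<noteq> 0"
  shows "x ^ (CARD('k) - 1) = 1"
proof -
  obtain \<omega> :: 'k where "\<exists>i. x = \<omega> ^ i" "\<omega> ^ (CARD('k) - 1) = 1"
    using finite_field_generator assms by (metis dvd_refl)
  then show ?thesis
    by (metis power_mult mult.commute power_one)
qed

lemma of_nat_card_eq_0: "of_nat CARD('k) = (0 :: 'k :: {field,finite})"
proof -
  have "(\<Sum>x\<in>(UNIV :: 'k set). x + 1) = (\<Sum>x\<in>UNIV. x)"
    by (rule sum.reindex_bij_witness[of _ "\<lambda>x. x - 1" "\<lambda>x. x + 1"]) auto
  then show ?thesis
    by (simp add: sum.distrib)
qed

text \<open>In \<open>\<kappa>\<close> one has \<open>q - 1 = -1 \<noteq> 0\<close>, so no divisor of \<open>q - 1\<close> vanishes there.\<close>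
lemma of_nat_dvd_card_minus_1:
  assumes "d dvd CARD('k :: {field,finite}) - 1"
  shows "of_nat d \<noteq> (0 :: 'k)"
proof
  assume "of_nat d = (0 :: 'k)"
  then have "of_nat (CARD('k) - 1) = (0 :: 'k)"
    using assms by (metis dvd_def mult_zero_left of_nat_mult)
  moreover have "of_nat (CARD('k) - 1) = (of_nat CARD('k) - 1 :: 'k)"
    using card_field_gt_1[where 'k = 'k] by (subst of_nat_diff) auto
  ultimately show False
    by (simp add: of_nat_card_eq_0)
qed

text \<open>The \<open>q\<close> elements of \<open>\<kappa>\<close> already exhaust the roots of \<open>X\<^sup>q - X\<close>.\<close>
lemma frobenius_fixed_iff:
  fixes y :: "'k :: {field,finite} alg_closure"
  shows "y ^ CARD('k) = y \<longleftrightarrow> y \<in> range to_ac"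
proof -
  define p where "p = Polynomial.monom (1 :: 'k alg_closure) CARD('k) + [:0, -1:]"
  have poly_p: "poly p y = y ^ CARD('k) - y" for y
    by (simp add: p_def poly_monom)
  have deg: "Polynomial.degree p = CARD('k)"
    using card_field_gt_1[where 'k = 'k] unfolding p_def
    by (subst degree_add_eq_left) (auto simp: Polynomial.degree_monom_eq)
  then have p0: "p \<noteq> 0"
    by auto
  have "x ^ CARD('k) = x" for x :: 'k
  proof (cases "x = 0")
    case False
    have "x ^ CARD('k) = x ^ (CARD('k) - 1) * x"
      using card_field_gt_1[where 'k = 'k] by (simp flip: power_Suc2)
    then show ?thesis
      using power_card_minus_1[OF False] by simp
  qed (simp add: zero_power)
  then have "poly p (to_ac x) = 0" for x
    unfolding poly_p by (metis to_ac_power diff_self)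
  then have "range to_ac \<subseteq> {y. poly p y = 0}"
    by blast
  moreover have "card {y. poly p y = 0} \<le> card (range (to_ac :: 'k \<Rightarrow> _))"
    using card_poly_roots_bound[OF p0] by (simp add: deg card_image inj_to_ac)
  ultimately have "range to_ac = {y. poly p y = 0}"
    by (intro card_seteq poly_roots_finite p0) auto
  then show ?thesis
    using poly_p by auto
qed

text \<open>The algebraic closure has \<open>d\<close> roots of unity of order dividing \<open>d\<close>. Since \<open>d\<close> divides
  \<open>q - 1\<close>, the \<open>q\<close>-Frobenius fixes them, so they all lie in \<open>\<kappa>\<close>.\<close>
lemma card_mu:
  assumes "d dvd CARD('k :: {field,finite}) - 1"
  shows "card (mu d :: 'k set) = d"
proof -
  have d0: "d > 0"
    using assms card_field_gt_1[where 'k = 'k] by (cases d) auto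
  have "to_ac ` (mu d :: 'k set) = {y. y ^ d = 1}"
  proof (intro equalityI subsetI)
    fix y :: "'k alg_closure"
    assume y: "y \<in> {y. y ^ d = 1}"
    then have "y ^ (CARD('k) - 1) = 1"
      using assms by (auto simp: power_mult)
    moreover have "CARD('k) = Suc (CARD('k) - 1)"
      using card_field_gt_1[where 'k = 'k] by simp
    ultimately have "y ^ CARD('k) = y"
      by (metis mult.right_neutral power_Suc)
    then obtain x where x: "y = to_ac x"
      using frobenius_fixed_iff by blast
    have "to_ac (x ^ d) = 1"
      using y by (simp add: x)
    then have "x ^ d = 1"
      by (simp only: to_ac_eq_1_iff)
    moreover from this have "x \<noteq> 0"
      using d0 by (metis zero_power zero_neq_one)
    ultimately have "x \<in> mu d"
      unfolding mu_def by blast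
    then show "y \<in> to_ac ` mu d"
      unfolding x by (rule imageI)
  next
    fix y :: "'k alg_closure"
    assume "y \<in> to_ac ` mu d"
    then obtain x where x: "y = to_ac x" "x ^ d = 1"
      unfolding mu_def by blast
    have "y ^ d = to_ac (x ^ d)"
      using x(1) by simp
    then show "y \<in> {y. y ^ d = 1}"
      by (simp only: x(2) to_ac_1 mem_Collect_eq)
  qed
  moreover have "of_nat d \<noteq> (0 :: 'k alg_closure)"
    using of_nat_dvd_card_minus_1[OF assms] by (simp flip: to_ac_of_nat)
  ultimately have "card (to_ac ` (mu d :: 'k set)) = d"
    by (simp add: card_nth_roots)
  then show ?thesis
    by (subst (asm) card_image) (auto intro: inj_on_subset[OF inj_to_ac])
qed

section \<open>Multiplicative characters\<close>

context
  fixes \<eta> :: "'k :: {field,finite} \<Rightarrow> qbar"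
  assumes \<eta>: "\<eta> \<in> mult_chars"
begin

lemma mult_char_0: "\<eta> 0 = 0"
  using \<eta> by (simp add: mult_chars_def)

lemma mult_char_eq_0_iff: "\<eta> x = 0 \<longleftrightarrow> x = 0"
  using \<eta> by (auto simp: mult_chars_def)

lemma mult_char_mult: "\<eta> (x * y) = \<eta> x * \<eta> y"
  using \<eta> by (cases "x = 0 \<or> y = 0") (auto simp: mult_chars_def)

lemma mult_char_1: "\<eta> 1 = 1"
  using mult_char_mult[of 1 1] mult_char_eq_0_iff[of 1] by simp

lemma mult_char_power: "\<eta> (x ^ n) = \<eta> x ^ n"
  by (induction n) (simp_all add: mult_char_1 mult_char_mult)

lemma mult_char_inverse: "\<eta> (inverse x) = inverse (\<eta> x)"
proof (cases "x = 0")
  case False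
  then have "\<eta> (inverse x) * \<eta> x = 1"
    by (simp add: mult_char_1 flip: mult_char_mult)
  then show ?thesis
    by (metis inverse_unique mult.commute)
qed (simp add: mult_char_0)

lemma mult_char_divide: "\<eta> (x / y) = \<eta> x / \<eta> y"
  by (simp add: divide_inverse mult_char_mult mult_char_inverse)

lemma mult_char_power_int: "\<eta> (x powi k) = \<eta> x powi k"
  by (simp add: power_int_def mult_char_power mult_char_inverse)

lemma mult_char_prod: "\<eta> (\<Prod>i\<in>A. f i) = (\<Prod>i\<in>A. \<eta> (f i))"
  by (induction A rule: infinite_finite_induct) (simp_all add: mult_char_1 mult_char_mult)

lemma mult_char_pow_card_minus_1: "x \<noteq> 0 \<Longrightarrow> \<eta> x ^ (CARD('k) - 1) = 1"
  using power_card_minus_1[of x] by (metis mult_char_1 mult_char_power)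

end

lemma mult_mult_chars:
  "\<eta> \<in> mult_chars \<Longrightarrow> \<theta> \<in> mult_chars \<Longrightarrow> (\<lambda>x. \<eta> x * \<theta> x) \<in> mult_chars"
  by (simp add: mult_chars_def)

lemma inverse_mult_chars: "\<eta> \<in> mult_chars \<Longrightarrow> (\<lambda>x. inverse (\<eta> x)) \<in> mult_chars"
  by (simp add: mult_chars_def)

lemma prod_mult_chars:
  assumes "\<And>i :: 'i :: finite. \<eta> i \<in> mult_chars"
  shows "(\<lambda>x. \<Prod>i\<in>UNIV. \<eta> i x) \<in> mult_chars"
  using assms by (simp add: mult_chars_def prod.distrib)

lemma char_group_simps:
  "carrier char_group = mult_chars"
  "\<eta> \<otimes>\<^bsub>char_group\<^esub> \<theta> = (\<lambda>x. \<eta> x * \<theta> x)"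
  "\<one>\<^bsub>char_group\<^esub> = triv_char"
  by (simp_all add: char_group_def)

lemma inv_char_group:
  assumes "\<eta> \<in> mult_chars"
  shows "inv\<^bsub>char_group\<^esub> \<eta> = (\<lambda>x. inverse (\<eta> x))"
proof -
  interpret comm_group "char_group :: ('a \<Rightarrow> qbar) monoid"
    by (rule comm_group_char_group)
  show ?thesis
    by (rule inv_equality)
      (use assms in \<open>auto simp: char_group_simps inverse_mult_chars triv_char_def
        mult_char_0 mult_char_eq_0_iff\<close>)
qed

lemma nat_pow_char_group:
  assumes "\<eta> \<in> mult_chars"
  shows "(\<eta> [^]\<^bsub>char_group\<^esub> (n :: nat)) x = (if x = 0 then 0 else \<eta> x ^ n)"
  using assms
  by (induction n) (simp_all add: char_group_simps triv_char_def mult_char_0)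

text \<open>The value at \<open>0\<close> has to be set apart: characters vanish at \<open>0\<close>, also when \<open>k = 0\<close>.\<close>
lemma int_pow_char_group:
  assumes "\<eta> \<in> mult_chars"
  shows "(\<eta> [^]\<^bsub>char_group\<^esub> (k :: int)) x = (if x = 0 then 0 else \<eta> x powi k)"
proof -
  interpret comm_group "char_group :: ('a \<Rightarrow> qbar) monoid"
    by (rule comm_group_char_group)
  have "\<eta> [^]\<^bsub>char_group\<^esub> n \<in> mult_chars" for n :: nat
    using assms nat_pow_closed[of \<eta> n] by (simp only: char_group_simps)
  then show ?thesis
    using assms
    by (cases k rule: int_cases2)
      (simp_all add: int_pow_int int_pow_neg_int char_group_simps inv_char_group nat_pow_char_group
        power_int_minus)
qed

lemma int_pow_mult_chars:
  "\<eta> \<in> mult_chars \<Longrightarrow> \<eta> [^]\<^bsub>char_group\<^esub> (k :: int) \<in> mult_chars"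
  using group.int_pow_closed[OF comm_group.axioms(2)[OF comm_group_char_group], of \<eta> k]
  by (simp add: char_group_simps)

lemma nat_pow_mult_chars:
  "\<eta> \<in> mult_chars \<Longrightarrow> \<eta> [^]\<^bsub>char_group\<^esub> (k :: nat) \<in> mult_chars"
  using int_pow_mult_chars[of \<eta> "int k"] by (simp add: int_pow_int)

lemma finprod_char_group:
  assumes "\<And>i :: 'i :: finite. \<nu> i \<in> mult_chars"
  shows "(\<Otimes>\<^bsub>char_group\<^esub>i\<in>UNIV. \<nu> i) = (\<lambda>x. \<Prod>i\<in>UNIV. \<nu> i x)"
proof -
  interpret comm_group "char_group :: ('a \<Rightarrow> qbar) monoid"
    by (rule comm_group_char_group)
  have "(\<Otimes>\<^bsub>char_group\<^esub>i\<in>A. \<nu> i) x = (if x = 0 then 0 else \<Prod>i\<in>A. \<nu> i x)" for A x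
  proof (induction A rule: infinite_finite_induct)
    case (insert a A)
    have "(\<Otimes>\<^bsub>char_group\<^esub>i\<in>insert a A. \<nu> i) = (\<lambda>x. \<nu> a x * (\<Otimes>\<^bsub>char_group\<^esub>i\<in>A. \<nu> i) x)"
      using insert.hyps assms by (subst finprod_insert) (auto simp: char_group_simps)
    then show ?case
      using insert by simp
  qed (simp_all add: char_group_simps triv_char_def)
  then show ?thesis
    using assms by (auto simp: fun_eq_iff mult_char_0)
qed

text \<open>A character is determined by its value at a generator \<open>\<omega>\<close> of \<open>\<kappa>\<^sup>\<times>\<close>. Conversely, for every
  \<open>\<zeta>\<close> with \<open>\<zeta>\<^bsup>q-1\<^esup> = 1\<close> the assignment \<open>\<omega>\<^sup>i \<mapsto> \<zeta>\<^sup>i\<close> is well defined.\<close>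
lemma bij_betw_eval_generator:
  fixes \<omega> :: "'k :: {field,finite}"
  assumes gen: "\<And>x. x \<noteq> 0 \<Longrightarrow> \<exists>i. x = \<omega> ^ i"
    and ord: "\<And>k. \<omega> ^ k = 1 \<longleftrightarrow> CARD('k) - 1 dvd k" and \<omega>: "\<omega> \<noteq> 0"
  shows "bij_betw (\<lambda>\<eta>. \<eta> \<omega>) mult_chars {\<zeta> :: qbar. \<zeta> ^ (CARD('k) - 1) = 1}"
proof (rule bij_betw_imageI)
  show "inj_on (\<lambda>\<eta>. \<eta> \<omega>) (mult_chars :: ('k \<Rightarrow> qbar) set)"
  proof (intro inj_onI ext)
    fix \<eta> \<theta> :: "'k \<Rightarrow> qbar" and x
    assume *: "\<eta> \<in> mult_chars" "\<theta> \<in> mult_chars" "\<eta> \<omega> = \<theta> \<omega>"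
    show "\<eta> x = \<theta> x"
    proof (cases "x = 0")
      case False
      then obtain i where "x = \<omega> ^ i"
        using gen by blast
      then show ?thesis
        using * by (simp add: mult_char_power)
    qed (use * in \<open>simp add: mult_char_0\<close>)
  qed
  show "(\<lambda>\<eta>. \<eta> \<omega>) ` mult_chars = {\<zeta> :: qbar. \<zeta> ^ (CARD('k) - 1) = 1}"
  proof (intro equalityI subsetI)
    fix \<zeta> :: qbar
    assume "\<zeta> \<in> {\<zeta>. \<zeta> ^ (CARD('k) - 1) = 1}"
    then have \<zeta>: "\<zeta> ^ (CARD('k) - 1) = 1"
      by simp
    have \<zeta>0: "\<zeta> \<noteq> 0"
      using \<zeta> card_field_gt_1[where 'k = 'k] by (auto simp: zero_power)
    have cong: "\<zeta> ^ i = \<zeta> ^ j" if "\<omega> ^ i = \<omega> ^ j" for i j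
    proof -
      have *: "\<zeta> ^ i = \<zeta> ^ j" if "i \<le> j" "\<omega> ^ i = \<omega> ^ j" for i j
      proof -
        have "\<omega> ^ i * \<omega> ^ (j - i) = \<omega> ^ j"
          using that(1) by (simp flip: power_add)
        then have "\<omega> ^ i * \<omega> ^ (j - i) = \<omega> ^ i * 1"
          by (simp only: that(2) mult_1_right)
        then have "\<omega> ^ (j - i) = 1"
          using \<omega> by simp
        then have "CARD('k) - 1 dvd j - i"
          using ord by blast
        then have "\<zeta> ^ (j - i) = 1"
          using \<zeta> by (elim dvdE) (simp add: power_mult)
        then show ?thesis
          using that(1) by (metis le_add_diff_inverse mult.right_neutral power_add)
      qed
      show ?thesis
        using *[OF _ that] *[OF _ that[symmetric]] by (metis nat_le_linear)
    qed
    define \<eta> where "\<eta> x = (if x = 0 then 0 else \<zeta> ^ (SOME i. x = \<omega> ^ i))" for x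
    have \<eta>_pow: "\<eta> (\<omega> ^ i) = \<zeta> ^ i" for i
    proof -
      have "\<omega> ^ i = \<omega> ^ (SOME j. \<omega> ^ i = \<omega> ^ j)"
        by (rule someI[of _ i]) simp
      then show ?thesis
        using \<omega> cong[of i "SOME j. \<omega> ^ i = \<omega> ^ j"] by (simp add: \<eta>_def)
    qed
    have "\<eta> (x * y) = \<eta> x * \<eta> y" if nz: "x \<noteq> 0" "y \<noteq> 0" for x y
    proof -
      obtain i j where "x = \<omega> ^ i" "y = \<omega> ^ j"
        using gen[OF nz(1)] gen[OF nz(2)] by blast
      then show ?thesis
        using \<eta>_pow[of "i + j"] by (simp add: \<eta>_pow power_add)
    qed
    moreover have "\<eta> 0 = 0" "\<And>x. x \<noteq> 0 \<Longrightarrow> \<eta> x \<noteq> 0"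
      using \<zeta>0 by (simp_all add: \<eta>_def)
    ultimately have "\<eta> \<in> mult_chars"
      by (simp add: mult_chars_def)
    moreover have "\<eta> \<omega> = \<zeta>"
      using \<eta>_pow[of 1] by simp
    ultimately show "\<zeta> \<in> (\<lambda>\<eta>. \<eta> \<omega>) ` mult_chars"
      by blast
  next
    fix \<zeta> :: qbar
    assume "\<zeta> \<in> (\<lambda>\<eta>. \<eta> \<omega>) ` mult_chars"
    then show "\<zeta> \<in> {\<zeta>. \<zeta> ^ (CARD('k) - 1) = 1}"
      using mult_char_pow_card_minus_1[OF _ \<omega>] by blast
  qed
qed

lemma card_mult_chars: "card (mult_chars :: ('k :: {field,finite} \<Rightarrow> qbar) set) = CARD('k) - 1"
proof -
  obtain \<omega> :: 'k where "\<omega> \<noteq> 0" "\<And>x. x \<noteq> 0 \<Longrightarrow> \<exists>i. x = \<omega> ^ i"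
    "\<And>k. \<omega> ^ k = 1 \<longleftrightarrow> CARD('k) - 1 dvd k"
    using finite_field_generator by blast
  then have "bij_betw (\<lambda>\<eta>. \<eta> \<omega>) mult_chars {\<zeta> :: qbar. \<zeta> ^ (CARD('k) - 1) = 1}"
    by (intro bij_betw_eval_generator) auto
  then have "card (mult_chars :: ('k \<Rightarrow> qbar) set) = card {\<zeta> :: qbar. \<zeta> ^ (CARD('k) - 1) = 1}"
    by (rule bij_betw_same_card)
  also have "\<dots> = CARD('k) - 1"
    using card_field_gt_1[where 'k = 'k] by (intro card_nth_roots) auto
  finally show ?thesis .
qed

lemma finite_mult_chars: "finite (mult_chars :: ('k :: {field,finite} \<Rightarrow> qbar) set)"
  using card_mult_chars[where 'k = 'k] card_field_gt_1[where 'k = 'k]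
  by (metis card.infinite less_numeral_extra(3) zero_less_diff)

text \<open>If \<open>t = \<omega>\<^sup>j\<close> with \<open>0 < j < q - 1\<close>, then \<open>\<zeta>\<^sup>j = 1\<close> has only \<open>j\<close> solutions, so some
  \<open>(q - 1)\<close>-th root of unity \<open>\<zeta>\<close> is not among them; the character with \<open>\<omega> \<mapsto> \<zeta>\<close> does
  the job.\<close>
lemma mult_chars_separate_1:
  fixes t :: "'k :: {field,finite}"
  assumes "t \<noteq> 0" "t \<noteq> 1"
  obtains \<nu> :: "'k \<Rightarrow> qbar" where "\<nu> \<in> mult_chars" "\<nu> t \<noteq> 1"
proof -
  obtain \<omega> :: 'k where \<omega>: "\<omega> \<noteq> 0" "\<And>x. x \<noteq> 0 \<Longrightarrow> \<exists>i. x = \<omega> ^ i"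
    "\<And>k. \<omega> ^ k = 1 \<longleftrightarrow> CARD('k) - 1 dvd k"
    using finite_field_generator by blast
  let ?N = "CARD('k) - 1"
  have N: "?N > 0"
    using card_field_gt_1[where 'k = 'k] by simp
  obtain i where i: "t = \<omega> ^ i"
    using \<omega>(2) assms(1) by blast
  define j where "j = i mod ?N"
  have j: "j > 0" "j < ?N"
    using assms(2) \<omega>(3)[of i] N by (auto simp: i j_def mod_greater_zero_iff_not_dvd)
  have "card {\<zeta> :: qbar. \<zeta> ^ j = 1} = j" "card {\<zeta> :: qbar. \<zeta> ^ ?N = 1} = ?N"
    using j N by (auto intro!: card_nth_roots)
  then have "\<not> {\<zeta> :: qbar. \<zeta> ^ ?N = 1} \<subseteq> {\<zeta>. \<zeta> ^ j = 1}"
    using j card_mono[of "{\<zeta> :: qbar. \<zeta> ^ j = 1}" "{\<zeta> :: qbar. \<zeta> ^ ?N = 1}"]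
    by (metis card.infinite less_numeral_extra(3) linorder_not_less)
  then obtain \<zeta> :: qbar where \<zeta>: "\<zeta> ^ ?N = 1" "\<zeta> ^ j \<noteq> 1"
    by blast
  have "bij_betw (\<lambda>\<eta>. \<eta> \<omega>) mult_chars {\<zeta> :: qbar. \<zeta> ^ (CARD('k) - 1) = 1}"
    by (intro bij_betw_eval_generator \<omega>)
  then have "\<zeta> \<in> (\<lambda>\<eta>. \<eta> \<omega>) ` (mult_chars :: ('k \<Rightarrow> qbar) set)"
    using \<zeta>(1) by (simp add: bij_betw_def)
  then obtain \<nu> :: "'k \<Rightarrow> qbar" where \<nu>: "\<nu> \<in> mult_chars" "\<nu> \<omega> = \<zeta>"
    by blast
  have "\<zeta> ^ i = \<zeta> ^ j"
  proof -
    have "\<zeta> ^ (?N * (i div ?N) + i mod ?N) = \<zeta> ^ (i mod ?N)"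
      using \<zeta>(1) unfolding power_add power_mult by simp
    then show ?thesis
      by (simp only: mult_div_mod_eq j_def)
  qed
  then have "\<nu> t \<noteq> 1"
    using \<nu> \<zeta>(2) by (simp add: i mult_char_power)
  then show thesis
    using that \<nu>(1) by blast
qed

text \<open>The two orthogonality relations have the same proof: multiplying the sum by a value
  \<open>\<noteq> 1\<close> only permutes its terms.\<close>
lemma sum_mult_char:
  fixes \<eta> :: "'k :: {field,finite} \<Rightarrow> qbar"
  assumes \<eta>: "\<eta> \<in> mult_chars"
  shows "(\<Sum>x\<in>UNIV - {0}. \<eta> x) = (if \<eta> = triv_char then of_nat CARD('k) - 1 else 0)"
proof (cases "\<eta> = triv_char")
  case True
  have "(\<Sum>x\<in>UNIV - {0}. \<eta> x) = (\<Sum>x\<in>UNIV - {0 :: 'k}. 1)"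
    by (rule sum.cong) (auto simp: True triv_char_def)
  then show ?thesis
    using True card_field_gt_1[where 'k = 'k] by (simp add: card_Diff_singleton)
next
  case False
  then obtain t where t: "t \<noteq> 0" "\<eta> t \<noteq> 1"
    using \<eta> by (auto simp: triv_char_def fun_eq_iff mult_char_0 split: if_splits)
  have "\<eta> t * (\<Sum>x\<in>UNIV - {0}. \<eta> x) = (\<Sum>x\<in>UNIV - {0}. \<eta> (t * x))"
    by (simp add: sum_distrib_left mult_char_mult[OF \<eta>])
  also have "\<dots> = (\<Sum>x\<in>UNIV - {0}. \<eta> x)"
    by (rule sum.reindex_bij_witness[of _ "\<lambda>x. x / t" "\<lambda>x. t * x"]) (use t in auto)
  finally show ?thesis
    using t False by simp
qed

lemma sum_over_mult_chars:
  fixes t :: "'k :: {field,finite}"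
  assumes t: "t \<noteq> 0"
  shows "(\<Sum>\<nu>\<in>mult_chars. \<nu> t :: qbar) = (if t = 1 then of_nat CARD('k) - 1 else 0)"
proof (cases "t = 1")
  case True
  then have "(\<Sum>\<nu>\<in>mult_chars. \<nu> t :: qbar) = (\<Sum>\<nu>\<in>(mult_chars :: ('k \<Rightarrow> qbar) set). 1)"
    by (intro sum.cong) (auto simp: mult_char_1)
  then show ?thesis
    using True card_field_gt_1[where 'k = 'k] by (simp add: card_mult_chars)
next
  case False
  obtain \<theta> :: "'k \<Rightarrow> qbar" where \<theta>: "\<theta> \<in> mult_chars" "\<theta> t \<noteq> 1"
    using mult_chars_separate_1[OF t False] .
  have cancel: "inverse (\<theta> x) * (\<theta> x * \<nu> x) = \<nu> x" "\<theta> x * (inverse (\<theta> x) * \<nu> x) = \<nu> x"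
    if "\<nu> \<in> mult_chars" for \<nu> x
    using mult_char_0[OF that] mult_char_eq_0_iff[OF \<theta>(1), of x] by (cases "x = 0"; simp)+
  have inv_closed: "(\<lambda>x. inverse (\<theta> x) * \<nu> x) \<in> mult_chars" if "\<nu> \<in> mult_chars" for \<nu>
    using mult_mult_chars[OF inverse_mult_chars[OF \<theta>(1)] that] .
  have "\<theta> t * (\<Sum>\<nu>\<in>mult_chars. \<nu> t) = (\<Sum>\<nu>\<in>mult_chars. \<theta> t * \<nu> t)"
    by (simp add: sum_distrib_left)
  also have "\<dots> = (\<Sum>\<nu>\<in>mult_chars. \<nu> t)"
    by (rule sum.reindex_bij_witness[of _ "\<lambda>\<nu> x. inverse (\<theta> x) * \<nu> x" "\<lambda>\<nu> x. \<theta> x * \<nu> x"])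
      (simp_all add: mult_mult_chars \<theta>(1) inv_closed cancel)
  finally show ?thesis
    using \<theta> False by simp
qed

section \<open>A generating character\<close>

context
  fixes \<phi> :: "'k :: {field,finite} \<Rightarrow> qbar"
  assumes \<phi>: "\<phi> \<in> mult_chars" and gen: "generate char_group {\<phi>} = mult_chars"
begin

text \<open>If \<open>\<phi> x = 1\<close>, then all powers of \<open>\<phi>\<close>, that is all characters, take the value \<open>1\<close> at
  \<open>x\<close>; and characters separate \<open>x\<close> from \<open>1\<close>.\<close>
lemma generating_char_eq_1_iff: "\<phi> x = 1 \<longleftrightarrow> x = 1"
proof
  assume x: "\<phi> x = 1"
  then have x0: "x \<noteq> 0"
    by (metis \<phi> mult_char_0 zero_neq_one)
  interpret comm_group "char_group :: ('k \<Rightarrow> qbar) monoid"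
    by (rule comm_group_char_group)
  have "\<nu> x = 1" if "\<nu> \<in> mult_chars" for \<nu> :: "'k \<Rightarrow> qbar"
  proof -
    have "\<phi> \<in> carrier char_group"
      using \<phi> by (simp add: char_group_simps)
    then have "\<nu> \<in> {\<phi> [^]\<^bsub>char_group\<^esub> k |k. k \<in> (UNIV :: int set)}"
      using that generate_pow[of \<phi>] gen by simp
    then obtain k :: int where "\<nu> = \<phi> [^]\<^bsub>char_group\<^esub> k"
      by blast
    then show ?thesis
      using x x0 \<phi> by (simp add: int_pow_char_group)
  qed
  then show "x = 1"
    using mult_chars_separate_1[OF x0] by metis
qed (simp add: mult_char_1[OF \<phi>])

text \<open>Orthogonality on \<open>\<mu>\<^sub>d\<close>. The restriction of \<open>\<phi>\<^sup>m\<close> is non-trivial unless \<open>d\<close> divides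
  \<open>m\<close>, because \<open>\<phi>\<close> is injective and \<open>X\<^sup>k - 1\<close> with \<open>0 < k < d\<close> has too few roots to vanish on
  \<open>\<mu>\<^sub>d\<close>.\<close>
lemma generating_char_sum_mu:
  assumes d: "d dvd CARD('k) - 1"
  shows "(\<Sum>\<xi>\<in>mu d. \<phi> \<xi> powi m) = (if int d dvd m then of_nat d else 0)"
proof (cases "int d dvd m")
  case True
  then obtain k where k: "m = int d * k" ..
  have "\<phi> \<xi> powi m = 1" if "\<xi> \<in> mu d" for \<xi>
  proof -
    have "\<phi> \<xi> ^ d = 1"
      using that by (simp add: mu_def mult_char_1[OF \<phi>] flip: mult_char_power[OF \<phi>])
    then show ?thesis
      by (simp add: k power_int_mult)
  qed
  then show ?thesis
    using True by (simp add: card_mu[OF d])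
next
  case False
  have d0: "d > 0"
    using d card_field_gt_1[where 'k = 'k] by (cases d) auto
  \<comment> \<open>exponents matter modulo \<open>d\<close> only; the residue is a natural number in \<open>{1..<d}\<close>\<close>
  define k where "k = nat (m mod int d)"
  have k_m: "int k = m mod int d"
    using d0 by (simp add: k_def)
  have "m mod int d \<noteq> 0" "m mod int d < int d"
    using False d0 by (simp_all add: dvd_eq_mod_eq_0)
  then have k: "k > 0" "k < d" "int k = m mod int d"
    using k_m by linarith+
  have "\<exists>\<xi>\<in>mu d :: 'k set. \<xi> ^ k \<noteq> 1"
  proof (rule ccontr)
    assume "\<not> ?thesis"
    then have "(mu d :: 'k set) \<subseteq> {\<xi>. \<xi> ^ k = 1}"
      by blast
    from card_mono[OF finite_nth_roots[OF k(1)] this] show False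
      using card_nth_roots_le[OF k(1), of "1 :: 'k"] k(2) by (simp add: card_mu[OF d])
  qed
  then obtain \<xi>\<^sub>0 :: 'k where \<xi>\<^sub>0: "\<xi>\<^sub>0 \<in> mu d" "\<xi>\<^sub>0 ^ k \<noteq> 1"
    by blast
  have \<xi>\<^sub>0': "\<xi>\<^sub>0 \<noteq> 0" "\<xi>\<^sub>0 ^ d = 1"
    using \<xi>\<^sub>0(1) by (auto simp: mu_def)
  have "\<xi>\<^sub>0 powi m = \<xi>\<^sub>0 powi (int d * (m div int d) + int k)"
    by (simp add: k(3))
  also have "\<dots> = \<xi>\<^sub>0 ^ k"
    using \<xi>\<^sub>0' by (subst power_int_add) (simp_all add: power_int_mult)
  finally have "\<phi> \<xi>\<^sub>0 powi m \<noteq> 1"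
    using \<xi>\<^sub>0(2) by (simp add: generating_char_eq_1_iff flip: mult_char_power_int[OF \<phi>])
  moreover have "\<phi> \<xi>\<^sub>0 powi m * (\<Sum>\<xi>\<in>mu d. \<phi> \<xi> powi m) = (\<Sum>\<xi>\<in>mu d. \<phi> \<xi> powi m)"
  proof -
    have "\<phi> \<xi>\<^sub>0 powi m * (\<Sum>\<xi>\<in>mu d. \<phi> \<xi> powi m) = (\<Sum>\<xi>\<in>mu d. \<phi> (\<xi>\<^sub>0 * \<xi>) powi m)"
      by (simp add: sum_distrib_left mult_char_mult[OF \<phi>] power_int_mult_distrib)
    also have "\<dots> = (\<Sum>\<xi>\<in>mu d. \<phi> \<xi> powi m)"
      by (rule sum.reindex_bij_witness[of _ "\<lambda>x. x / \<xi>\<^sub>0" "\<lambda>x. \<xi>\<^sub>0 * x"])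
        (use \<xi>\<^sub>0' in \<open>auto simp: mu_def power_mult_distrib power_divide\<close>)
    finally show ?thesis .
  qed
  ultimately show ?thesis
    using False by simp
qed

text \<open>Evaluated at a generator \<open>\<omega>\<close> of \<open>\<kappa>\<^sup>\<times>\<close>, the power is trivial iff
  \<open>\<omega>\<^bsup>m (q-1)/d\<^esup> = 1\<close>, since \<open>\<phi>\<close> is injective.\<close>
lemma generating_char_pow_eq_triv_iff:
  assumes d: "d dvd CARD('k) - 1"
  shows "(\<phi> [^]\<^bsub>char_group\<^esub> ((CARD('k) - 1) div d)) [^]\<^bsub>char_group\<^esub> (m :: int) = triv_char
    \<longleftrightarrow> int d dvd m"
proof -
  let ?N = "CARD('k) - 1"
  let ?e = "?N div d"
  have e: "d * ?e = ?N"
    using d by simp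
  moreover have "?N > 0"
    using card_field_gt_1[where 'k = 'k] by simp
  ultimately have d0: "d > 0" and e0: "?e > 0"
    by (metis mult_eq_0_iff neq0_conv)+
  have val: "((\<phi> [^]\<^bsub>char_group\<^esub> ?e) [^]\<^bsub>char_group\<^esub> m) x = \<phi> (x powi (int ?e * m))" if "x \<noteq> 0" for x
    using that \<phi>
    by (simp add: int_pow_char_group nat_pow_mult_chars nat_pow_char_group
        mult_char_power_int[OF \<phi>] mult_char_power[OF \<phi>] power_int_mult)
  obtain \<omega> :: 'k where \<omega>: "\<omega> \<noteq> 0" "\<And>k. \<omega> ^ k = 1 \<longleftrightarrow> ?N dvd k"
    using finite_field_generator by metis
  show ?thesis
  proof
    assume "(\<phi> [^]\<^bsub>char_group\<^esub> ?e) [^]\<^bsub>char_group\<^esub> m = triv_char"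
    then have "\<phi> (\<omega> powi (int ?e * m)) = 1"
      using val[OF \<omega>(1)] \<omega>(1) by (simp add: triv_char_def)
    then have 1: "\<omega> powi (int ?e * m) = 1"
      by (simp add: generating_char_eq_1_iff)
    have "\<omega> ^ nat \<bar>int ?e * m\<bar> = 1"
      using 1 by (auto simp: power_int_def abs_if not_less mult_le_0_iff power_inverse split: if_splits)
    then have "int ?N dvd int (nat \<bar>int ?e * m\<bar>)"
      by (simp only: \<omega>(2) int_dvd_int_iff)
    then have "int ?N dvd int ?e * m"
      by (simp only: nat_0_le abs_ge_zero dvd_abs_iff)
    then have "int ?e * int d dvd int ?e * m"
      by (metis e mult.commute of_nat_mult)
    then show "int d dvd m"
      using e0 by simp
  next
    assume "int d dvd m"
    then obtain k where k: "m = int d * k" ..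
    have "x powi (int ?e * m) = 1" if "x \<noteq> 0" for x :: 'k
    proof -
      have "int ?e * m = int ?N * k"
        by (metis e k mult.assoc mult.commute of_nat_mult)
      then show ?thesis
        using power_card_minus_1[OF that] by (simp add: power_int_mult del: of_nat_diff)
    qed
    then show "(\<phi> [^]\<^bsub>char_group\<^esub> ?e) [^]\<^bsub>char_group\<^esub> m = triv_char"
      using val \<phi> by (auto simp: fun_eq_iff triv_char_def mult_char_1
          mult_char_0[OF int_pow_mult_chars[OF nat_pow_mult_chars]])
  qed
qed

end

section \<open>Gauss and Jacobi sums\<close>

lemma sum_nonzero_eq:
  fixes f :: "'a :: {zero,finite} \<Rightarrow> 'b :: ab_group_add"
  shows "(\<Sum>x\<in>UNIV - {0}. f x) = (\<Sum>x\<in>UNIV. f x) - f 0"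
  by (simp add: sum_diff1)

context
  fixes \<psi> :: "'k :: {field,finite} \<Rightarrow> qbar"
  assumes \<psi>: "nontriv_add_char \<psi>"
begin

lemma add_char_add: "\<psi> (x + y) = \<psi> x * \<psi> y"
  using \<psi> by (simp add: nontriv_add_char_def)

lemma add_char_0: "\<psi> 0 = 1"
  using \<psi> add_char_add[of 0 0] by (simp add: nontriv_add_char_def)

lemma add_char_sum: "\<psi> (\<Sum>i\<in>A. f i) = (\<Prod>i\<in>A. \<psi> (f i))"
  by (induction A rule: infinite_finite_induct) (simp_all add: add_char_0 add_char_add)

lemma sum_add_char: "(\<Sum>x\<in>UNIV. \<psi> (s * x)) = (if s = 0 then of_nat CARD('k) else 0)"
proof (cases "s = 0")
  case False
  obtain t where t: "\<psi> t \<noteq> 1"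
    using \<psi> by (auto simp: nontriv_add_char_def)
  have "\<psi> t * (\<Sum>x\<in>UNIV. \<psi> (s * x)) = (\<Sum>x\<in>UNIV. \<psi> (s * (x + t / s)))"
    using False by (simp add: sum_distrib_left add_char_add distrib_left mult.commute)
  also have "\<dots> = (\<Sum>x\<in>UNIV. \<psi> (s * x))"
    by (rule sum.reindex_bij_witness[of _ "\<lambda>x. x - t / s" "\<lambda>x. x + t / s"]) auto
  finally show ?thesis
    using t False by simp
qed (simp add: add_char_0)

lemma sum_add_char_nonzero:
  "(\<Sum>x\<in>UNIV - {0}. \<psi> (s * x)) = (if s = 0 then of_nat CARD('k) else 0) - 1"
  by (simp add: sum_nonzero_eq sum_add_char add_char_0)

lemma gauss_sum_triv: "gauss_sum \<psi> triv_char = 1"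
proof -
  have "(\<Sum>x\<in>UNIV - {0}. \<psi> x * triv_char x) = (\<Sum>x\<in>UNIV - {0}. \<psi> (1 * x))"
    by (rule sum.cong) (auto simp: triv_char_def)
  then show ?thesis
    by (simp add: gauss_sum_def sum_add_char_nonzero del: mult_1_left)
qed

text \<open>The substitution \<open>x \<mapsto> x / s\<close>. For \<open>s = 0\<close> both sides vanish, the left one
  by orthogonality since \<open>\<eta>\<close> is non-trivial.\<close>
lemma gauss_sum_twist:
  assumes \<eta>: "\<eta> \<in> mult_chars" "\<eta> \<noteq> triv_char"
  shows "(\<Sum>x\<in>UNIV - {0}. \<psi> (s * x) * \<eta> x) = - gauss_sum \<psi> \<eta> * inverse (\<eta> s)"
proof (cases "s = 0")
  case True
  then show ?thesis
    using sum_mult_char[OF \<eta>(1)] \<eta>(2) by (simp add: add_char_0 mult_char_0[OF \<eta>(1)])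
next
  case False
  have "(\<Sum>x\<in>UNIV - {0}. \<psi> (s * x) * \<eta> x) = (\<Sum>x\<in>UNIV - {0}. \<psi> x * \<eta> (x / s))"
    by (rule sum.reindex_bij_witness[of _ "\<lambda>x. x / s" "\<lambda>x. s * x"]) (use False in auto)
  then show ?thesis
    by (simp add: gauss_sum_def mult_char_mult[OF \<eta>(1)] mult_char_inverse[OF \<eta>(1)]
        divide_inverse sum_distrib_right mult.assoc)
qed

text \<open>For non-trivial \<open>\<eta>\<close>, twisting turns \<open>g(\<eta>) g(\<eta>\<^sup>-\<^sup>1)\<close> into
  \<open>\<Sum>\<^sub>x \<eta>(x) \<Sum>\<^sub>y \<psi>((1 + x) y)\<close>, whose inner sum is \<open>q - 1\<close> at \<open>x = -1\<close> and \<open>-1\<close> elsewhere.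
  The factor \<open>q\<close> in \<open>g\<^sup>\<circ>(\<epsilon>)\<close> makes the same formula hold for \<open>\<eta> = \<epsilon>\<close>. In particular no Gauss
  sum vanishes, so that all quotients below are genuine.\<close>
lemma gauss_sum_circ_mult_inverse:
  assumes \<eta>: "\<eta> \<in> mult_chars"
  shows "gauss_sum_circ \<psi> \<eta> * gauss_sum \<psi> (\<lambda>x. inverse (\<eta> x)) = of_nat CARD('k) * \<eta> (-1)"
proof (cases "\<eta> = triv_char")
  case True
  then have "(\<lambda>x. inverse (\<eta> x)) = triv_char"
    by (auto simp: triv_char_def)
  then show ?thesis
    using True by (simp add: gauss_sum_circ_def gauss_sum_triv) (simp add: triv_char_def)
next
  case False
  have "gauss_sum \<psi> \<eta> * gauss_sum \<psi> (\<lambda>x. inverse (\<eta> x)) =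
      (\<Sum>y\<in>UNIV - {0}. \<psi> y * (- gauss_sum \<psi> \<eta> * inverse (\<eta> y)))"
    by (subst (2) gauss_sum_def) (simp add: sum_distrib_left algebra_simps flip: sum_negf)
  also have "\<dots> = (\<Sum>y\<in>UNIV - {0}. \<Sum>x\<in>UNIV - {0}. \<psi> ((1 + x) * y) * \<eta> x)"
    unfolding gauss_sum_twist[OF \<eta> False, symmetric]
    by (simp add: sum_distrib_left add_char_add distrib_left distrib_right mult_ac)
  also have "\<dots> = (\<Sum>x\<in>UNIV - {0}. (\<Sum>y\<in>UNIV - {0}. \<psi> ((1 + x) * y)) * \<eta> x)"
    by (subst sum.swap) (simp add: sum_distrib_right)
  also have "\<dots> = (\<Sum>x\<in>UNIV - {0}. (if x = -1 then of_nat CARD('k) * \<eta> x else 0) - \<eta> x)"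
    by (rule sum.cong, rule refl, subst sum_add_char_nonzero)
      (auto simp: algebra_simps eq_neg_iff_add_eq_0 add.commute)
  also have "\<dots> = of_nat CARD('k) * \<eta> (-1)"
    using sum_mult_char[OF \<eta>] False by (simp add: sum_subtractf sum.delta)
  finally show ?thesis
    using False by (simp add: gauss_sum_circ_def)
qed

lemma gauss_sum_circ_nonzero:
  assumes \<eta>: "\<eta> \<in> mult_chars"
  shows "gauss_sum_circ \<psi> \<eta> \<noteq> 0"
proof
  assume "gauss_sum_circ \<psi> \<eta> = 0"
  then show False
    using gauss_sum_circ_mult_inverse[OF \<eta>] by (simp add: mult_char_eq_0_iff[OF \<eta>])
qed

lemma gauss_sum_nonzero: "\<eta> \<in> mult_chars \<Longrightarrow> gauss_sum \<psi> \<eta> \<noteq> 0"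
  using gauss_sum_circ_nonzero[of \<eta>] by (auto simp: gauss_sum_circ_def)

text \<open>The finite field analogue of \<open>(1 - t)\<^bsup>-\<alpha>\<^esup> = \<Sum>\<^sub>n (\<alpha>)\<^sub>n / n! t\<^sup>n\<close>. Since
  \<open>q / g\<^sup>\<circ>(\<nu>) = \<nu>(-1) g(\<nu>\<^sup>-\<^sup>1)\<close>, the summand is a double sum over \<open>x\<close> and \<open>y\<close> which depends on
  \<open>\<nu>\<close> only through \<open>\<nu>(-t x / y)\<close>. Summing over \<open>\<nu>\<close> first leaves the terms with \<open>y = - t x\<close>, and
  these form a twisted Gauss sum of \<open>\<alpha>\<close>. Non-triviality of \<open>\<alpha>\<close> makes the formula correct
  at \<open>t = 1\<close>, where both sides are \<open>0\<close>.\<close>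
lemma binomial_theorem_mult_char:
  assumes \<alpha>: "\<alpha> \<in> mult_chars" "\<alpha> \<noteq> triv_char" and t: "t \<noteq> 0"
  shows "1 / (1 - of_nat CARD('k)) *
    (\<Sum>\<nu>\<in>mult_chars. poch \<psi> \<alpha> \<nu> / poch_circ \<psi> triv_char \<nu> * \<nu> t) = inverse (\<alpha> (1 - t))"
proof -
  define q where "q = (of_nat CARD('k) :: qbar)"
  have q1: "q \<noteq> 1" and q0: "q \<noteq> 0"
    using card_field_gt_1[where 'k = 'k] by (simp_all add: q_def)
  have summand: "poch \<psi> \<alpha> \<nu> / poch_circ \<psi> triv_char \<nu> * \<nu> t =
      (\<Sum>x\<in>UNIV - {0}. \<Sum>y\<in>UNIV - {0}. \<psi> x * \<psi> y * \<alpha> x * \<nu> (- t * x / y)) / gauss_sum \<psi> \<alpha>"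
    if \<nu>: "\<nu> \<in> mult_chars" for \<nu>
  proof -
    have triv: "(\<lambda>x. triv_char x * \<nu> x) = \<nu>"
      using mult_char_0[OF \<nu>] by (auto simp: triv_char_def)
    have neg: "\<nu> (-1) * \<nu> (-1) = 1"
      using mult_char_mult[OF \<nu>, of "-1" "-1"] by (simp add: mult_char_1[OF \<nu>])
    have "gauss_sum \<psi> (\<lambda>x. inverse (\<nu> x)) * \<nu> (-1) * gauss_sum_circ \<psi> \<nu> = q * (\<nu> (-1) * \<nu> (-1))"
      using gauss_sum_circ_mult_inverse[OF \<nu>] by (simp add: q_def mult_ac)
    then have inv: "q / gauss_sum_circ \<psi> \<nu> = gauss_sum \<psi> (\<lambda>x. inverse (\<nu> x)) * \<nu> (-1)"
      using gauss_sum_circ_nonzero[OF \<nu>] by (simp add: neg divide_eq_eq)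
    have "poch \<psi> \<alpha> \<nu> / poch_circ \<psi> triv_char \<nu> * \<nu> t =
        gauss_sum \<psi> (\<lambda>x. \<alpha> x * \<nu> x) * (q / gauss_sum_circ \<psi> \<nu>) * \<nu> t / gauss_sum \<psi> \<alpha>"
      by (simp add: poch_def poch_circ_def char_group_simps triv gauss_sum_circ_def[of \<psi> triv_char]
          gauss_sum_triv q_def)
    also have "\<dots> = gauss_sum \<psi> (\<lambda>x. \<alpha> x * \<nu> x) * gauss_sum \<psi> (\<lambda>x. inverse (\<nu> x)) * \<nu> (- t)
        / gauss_sum \<psi> \<alpha>"
      using mult_char_mult[OF \<nu>, of "-1" t] by (simp add: inv)
    also have "gauss_sum \<psi> (\<lambda>x. \<alpha> x * \<nu> x) * gauss_sum \<psi> (\<lambda>x. inverse (\<nu> x)) * \<nu> (- t) =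
        (\<Sum>x\<in>UNIV - {0}. \<Sum>y\<in>UNIV - {0}. \<psi> x * \<psi> y * \<alpha> x * \<nu> (- t * x / y))"
    proof -
      have "\<nu> (- t * x / y) = \<nu> (- t) * \<nu> x * inverse (\<nu> y)" for x y
        by (simp only: mult_char_divide[OF \<nu>] mult_char_mult[OF \<nu>] mult_char_inverse[OF \<nu>] divide_inverse)
      then show ?thesis
        unfolding gauss_sum_def minus_mult_minus sum_product
        by (simp only: sum_distrib_right sum_distrib_left mult_ac)
    qed
    finally show ?thesis .
  qed
  have "(\<Sum>\<nu>\<in>mult_chars. poch \<psi> \<alpha> \<nu> / poch_circ \<psi> triv_char \<nu> * \<nu> t) * gauss_sum \<psi> \<alpha> =
      (\<Sum>\<nu>\<in>mult_chars. \<Sum>x\<in>UNIV - {0}. \<Sum>y\<in>UNIV - {0}. \<psi> x * \<psi> y * \<alpha> x * \<nu> (- t * x / y))"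
    unfolding sum_distrib_right
    by (rule sum.cong, rule refl, subst summand) (use gauss_sum_nonzero[OF \<alpha>(1)] in simp_all)
  also have "\<dots> = (\<Sum>x\<in>UNIV - {0}. \<Sum>y\<in>UNIV - {0}. \<psi> x * \<psi> y * \<alpha> x *
      (\<Sum>\<nu>\<in>mult_chars. \<nu> (- t * x / y)))"
    by (subst sum.swap, rule sum.cong, rule refl, subst sum.swap) (simp add: sum_distrib_left)
  also have "\<dots> = (\<Sum>x\<in>UNIV - {0}. \<Sum>y\<in>UNIV - {0}.
      if y = - t * x then \<psi> x * \<psi> y * \<alpha> x * (q - 1) else 0)"
  proof (intro sum.cong refl)
    fix x y :: 'k
    assume "x \<in> UNIV - {0}" "y \<in> UNIV - {0}"
    then have "- t * x / y \<noteq> 0" and *: "- t * x / y = 1 \<longleftrightarrow> y = - t * x"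
      using t by (auto simp: divide_eq_1_iff simp del: divide_minus_left)
    then show "\<psi> x * \<psi> y * \<alpha> x * (\<Sum>\<nu>\<in>mult_chars. \<nu> (- t * x / y)) =
        (if y = - t * x then \<psi> x * \<psi> y * \<alpha> x * (q - 1) else 0)"
      unfolding sum_over_mult_chars[OF \<open>- t * x / y \<noteq> 0\<close>] * q_def by simp
  qed
  also have "\<dots> = (\<Sum>x\<in>UNIV - {0}. \<psi> x * \<psi> (- t * x) * \<alpha> x * (q - 1))"
    using t by (intro sum.cong) (simp_all add: sum.delta)
  also have "\<dots> = (\<Sum>x\<in>UNIV - {0}. \<psi> ((1 - t) * x) * \<alpha> x) * (q - 1)"
    unfolding sum_distrib_right
    by (intro sum.cong refl) (simp add: algebra_simps flip: add_char_add)
  also have "\<dots> = (1 - q) * inverse (\<alpha> (1 - t)) * gauss_sum \<psi> \<alpha>"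
    unfolding gauss_sum_twist[OF \<alpha>] by (simp add: algebra_simps)
  finally show ?thesis
    using gauss_sum_nonzero[OF \<alpha>(1)] q1 by (simp add: q_def)
qed

text \<open>Let \<open>A(s)\<close> be the sum of \<open>\<Prod>\<^sub>i \<eta>\<^sub>i(x\<^sub>i)\<close> over the \<open>x\<close> with coordinate sum \<open>s\<close>, and \<open>\<theta>\<close> the
  product of the \<open>\<eta>\<^sub>i\<close>. Scaling gives \<open>A(s) = \<theta>(s) A(1)\<close> for \<open>s \<noteq> 0\<close>, and \<open>A(0)\<close> is found from
  \<open>\<Sum>\<^sub>s A(s) = \<Prod>\<^sub>i \<Sum>\<^sub>x \<eta>\<^sub>i(x) = 0\<close>, where one non-trivial factor is enough. The product of the
  Gauss sums is, up to sign, \<open>\<Sum>\<^sub>s \<psi>(s) A(s)\<close>. The term \<open>A(0)\<close> is non-zero only for trivial \<open>\<theta>\<close>, and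
  there it accounts for the difference between \<open>g\<close> and \<open>g\<^sup>\<circ>\<close>.\<close>
lemma jacobi_sum_gauss_sum:
  fixes \<eta> :: "'i :: finite \<Rightarrow> 'k \<Rightarrow> qbar"
  assumes \<eta>: "\<And>i. \<eta> i \<in> mult_chars" and i: "\<eta> i \<noteq> triv_char"
  shows "jacobi_sum \<eta> * gauss_sum_circ \<psi> (\<lambda>x. \<Prod>i\<in>UNIV. \<eta> i x) = (\<Prod>i\<in>UNIV. gauss_sum \<psi> (\<eta> i))"
proof -
  define \<theta> where "\<theta> = (\<lambda>x. \<Prod>i\<in>UNIV. \<eta> i x)"
  have \<theta>: "\<theta> \<in> mult_chars"
    unfolding \<theta>_def by (rule prod_mult_chars) (rule \<eta>)
  define T where "T = {x :: 'i \<Rightarrow> 'k. \<forall>i. x i \<noteq> 0}"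
  define A where "A s = (\<Sum>x | (\<forall>i. x i \<noteq> 0) \<and> (\<Sum>i\<in>UNIV. x i) = s. \<Prod>i\<in>UNIV. \<eta> i (x i))" for s
  define B where "B = A 1"
  have scale: "A s = \<theta> s * B" if s: "s \<noteq> 0" for s
  proof -
    have "A s = (\<Sum>x | (\<forall>i. x i \<noteq> 0) \<and> (\<Sum>i\<in>UNIV. x i) = 1. \<Prod>i\<in>UNIV. \<eta> i (s * x i))"
      unfolding A_def
      by (rule sum.reindex_bij_witness[of _ "\<lambda>x i. s * x i" "\<lambda>x i. x i / s"])
        (use s in \<open>auto simp flip: sum_distrib_left sum_divide_distrib\<close>)
    then show ?thesis
      by (simp add: B_def A_def \<theta>_def mult_char_mult[OF \<eta>] prod.distrib sum_distrib_left)
  qed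
  have group: "(\<Sum>x\<in>T. f (\<Sum>i\<in>UNIV. x i) * (\<Prod>i\<in>UNIV. \<eta> i (x i))) = (\<Sum>s\<in>UNIV. f s * A s)"
    for f :: "'k \<Rightarrow> qbar"
  proof -
    have "(\<Sum>s\<in>UNIV. f s * A s) = (\<Sum>s\<in>UNIV. \<Sum>x | x \<in> T \<and> (\<Sum>i\<in>UNIV. x i) = s.
        f (\<Sum>i\<in>UNIV. x i) * (\<Prod>i\<in>UNIV. \<eta> i (x i)))"
      by (simp add: A_def T_def sum_distrib_left)
    also have "\<dots> = (\<Sum>x\<in>T. f (\<Sum>i\<in>UNIV. x i) * (\<Prod>i\<in>UNIV. \<eta> i (x i)))"
      by (rule sum.group) auto
    finally show ?thesis ..
  qed
  have T: "T = PiE UNIV (\<lambda>_. UNIV - {0})"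
    by (auto simp: T_def)
  have product: "(\<Prod>i\<in>UNIV. \<Sum>x\<in>UNIV - {0}. f x * \<eta> i x) = (\<Sum>x\<in>T. \<Prod>i\<in>UNIV. f (x i) * \<eta> i (x i))"
    for f
    unfolding T by (rule prod_sum_PiE) auto
  have "(\<Sum>s\<in>UNIV. A s) = (\<Prod>i\<in>UNIV. \<Sum>x\<in>UNIV - {0}. \<eta> i x)"
    using product[of "\<lambda>_. 1"] group[of "\<lambda>_. 1"] by simp
  also have "\<dots> = 0"
    using i by (intro prod_zero bexI[of _ i]) (simp_all add: sum_mult_char[OF \<eta>])
  finally have "A 0 = - (\<Sum>s\<in>UNIV - {0}. A s)"
    by (simp add: sum_nonzero_eq)
  also have "\<dots> = - B * (\<Sum>s\<in>UNIV - {0}. \<theta> s)"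
    by (simp add: scale sum_distrib_left mult.commute sum_negf)
  finally have A0: "A 0 = - B * (\<Sum>s\<in>UNIV - {0}. \<theta> s)" .
  have "(-1) ^ CARD('i) * (\<Prod>i\<in>UNIV. gauss_sum \<psi> (\<eta> i)) =
      (\<Prod>i\<in>UNIV. \<Sum>x\<in>UNIV - {0}. \<psi> x * \<eta> i x)"
    by (simp add: gauss_sum_def prod_uminus)
  also have "\<dots> = (\<Sum>s\<in>UNIV. \<psi> s * A s)"
    unfolding product group[symmetric] by (simp add: add_char_sum prod.distrib)
  also have "\<dots> = A 0 + (\<Sum>s\<in>UNIV - {0}. \<psi> s * A s)"
    by (simp add: sum_nonzero_eq add_char_0)
  also have "\<dots> = A 0 - B * gauss_sum \<psi> \<theta>"
    by (simp add: scale gauss_sum_def sum_distrib_left mult_ac)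
  also have "\<dots> = - (B * gauss_sum_circ \<psi> \<theta>)"
    by (simp add: A0 gauss_sum_circ_def sum_mult_char[OF \<theta>] gauss_sum_triv algebra_simps)
  finally have "(-1) ^ CARD('i) * (\<Prod>i\<in>UNIV. gauss_sum \<psi> (\<eta> i)) = - (B * gauss_sum_circ \<psi> \<theta>)" .
  moreover have "(-1) ^ CARD('i) = - ((-1) ^ (CARD('i) - 1) :: qbar)"
    using power_Suc[of "-1 :: qbar" "CARD('i) - 1"] by simp
  ultimately have "(-1) ^ (CARD('i) - 1) * (\<Prod>i\<in>UNIV. gauss_sum \<psi> (\<eta> i)) = B * gauss_sum_circ \<psi> \<theta>"
    by simp
  then have "(-1) ^ (CARD('i) - 1) * B * gauss_sum_circ \<psi> \<theta> =
      ((-1) ^ (CARD('i) - 1) * (-1) ^ (CARD('i) - 1)) * (\<Prod>i\<in>UNIV. gauss_sum \<psi> (\<eta> i))"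
    by (simp only: mult.assoc)
  then show ?thesis
    by (simp only: jacobi_sum_def B_def A_def \<theta>_def minus_one_mult_self mult_1_left)
qed

end

section \<open>The integral representation of the Lauricella function\<close>

lemma sum_UNIV_option: "(\<Sum>i\<in>UNIV. f i) = f None + (\<Sum>i\<in>UNIV. f (Some i))"
  for f :: "'n :: finite option \<Rightarrow> 'b :: comm_monoid_add"
  by (simp add: UNIV_option_conv sum.reindex)

lemma prod_UNIV_option: "(\<Prod>i\<in>UNIV. f i) = f None * (\<Prod>i\<in>UNIV. f (Some i))"
  for f :: "'n :: finite option \<Rightarrow> 'b :: comm_monoid_mult"
  by (simp add: UNIV_option_conv prod.reindex)

text \<open>Eliminating the last coordinate through \<open>x\<^sub>n\<^sub>+\<^sub>1 = 1 - \<Sum>\<^sub>i x\<^sub>i\<close>. The points with a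
  vanishing coordinate contribute \<open>0\<close>, as characters vanish at \<open>0\<close>, so the sum may run over the
  whole affine space.\<close>
lemma jacobi_sum_case_option:
  fixes \<beta> :: "'n :: finite \<Rightarrow> 'k :: {field,finite} \<Rightarrow> qbar"
  assumes \<beta>: "\<And>i. \<beta> i \<in> mult_chars" and \<gamma>: "\<gamma> \<in> mult_chars"
  shows "jacobi_sum (case_option \<gamma> \<beta>) =
    (-1) ^ CARD('n) * (\<Sum>x\<in>UNIV. (\<Prod>i\<in>UNIV. \<beta> i (x i)) * \<gamma> (1 - (\<Sum>i\<in>UNIV. x i)))"
proof -
  let ?X = "{x :: 'n option \<Rightarrow> 'k. (\<forall>i. x i \<noteq> 0) \<and> (\<Sum>i\<in>UNIV. x i) = 1}"
  let ?Y = "{x :: 'n \<Rightarrow> 'k. (\<forall>i. x i \<noteq> 0) \<and> 1 - (\<Sum>i\<in>UNIV. x i) \<noteq> 0}"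
  have "(\<Sum>x\<in>?X. \<Prod>i\<in>UNIV. case_option \<gamma> \<beta> i (x i)) =
      (\<Sum>x\<in>?Y. (\<Prod>i\<in>UNIV. \<beta> i (x i)) * \<gamma> (1 - (\<Sum>i\<in>UNIV. x i)))"
    by (rule sum.reindex_bij_witness[of _ "\<lambda>x. case_option (1 - (\<Sum>i\<in>UNIV. x i)) x" "\<lambda>x i. x (Some i)"])
      (auto simp: sum_UNIV_option prod_UNIV_option fun_eq_iff split: option.splits simp flip: eq_diff_eq)
  also have "\<dots> = (\<Sum>x\<in>UNIV. (\<Prod>i\<in>UNIV. \<beta> i (x i)) * \<gamma> (1 - (\<Sum>i\<in>UNIV. x i)))"
    by (rule sum.mono_neutral_left)
      (auto simp: mult_char_eq_0_iff[OF \<beta>] mult_char_eq_0_iff[OF \<gamma>])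
  finally show ?thesis
    by (simp add: jacobi_sum_def)
qed

text \<open>The analogue of the integral
  \<open>\<integral> \<Prod>\<^sub>i (1 - \<lambda>\<^sub>i x\<^sub>i)\<^bsup>-\<alpha>\<^sub>i\<^esup> x\<^sub>i\<^bsup>\<beta>\<^sub>i\<^esup> (1 - \<Sum>\<^sub>i x\<^sub>i)\<^bsup>\<gamma>\<^esup>\<close> for \<open>F\<^sub>B\<close> (with
  exponents up to the customary shift by one): expand each
  factor \<open>(1 - \<lambda>\<^sub>i x\<^sub>i)\<^bsup>-\<alpha>\<^sub>i\<^esup>\<close> by the binomial theorem and integrate term by term. The integral of
  the term of index \<open>\<nu>\<close> is the Jacobi sum of the \<open>\<beta>\<^sub>i \<nu>\<^sub>i\<close> and \<open>\<gamma>\<close>; in terms of Gauss sums, its quotient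
  by the Jacobi sum of the \<open>\<beta>\<^sub>i\<close> and \<open>\<gamma>\<close> consists of Pochhammer symbols.\<close>
lemma lauricella_B_integral_representation:
  fixes \<alpha> \<beta> :: "'n :: finite \<Rightarrow> 'k :: {field,finite} \<Rightarrow> qbar"
  assumes \<psi>: "nontriv_add_char \<psi>"
    and \<alpha>: "\<And>i. \<alpha> i \<in> mult_chars" "\<And>i. \<alpha> i \<noteq> triv_char"
    and \<beta>: "\<And>i. \<beta> i \<in> mult_chars"
    and \<gamma>: "\<gamma> \<in> mult_chars" "\<gamma> \<noteq> triv_char"
    and l: "\<And>i. l i \<noteq> 0"
  shows "(\<Sum>x\<in>UNIV. (\<Prod>i\<in>UNIV. inverse (\<alpha> i (1 - l i * x i)) * \<beta> i (x i)) *
      \<gamma> (1 - (\<Sum>i\<in>UNIV. x i))) =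
    (-1) ^ CARD('n) * jacobi_sum (case_option \<gamma> \<beta>) *
      lauricella_B \<psi> \<alpha> \<beta> (\<lambda>x. (\<Prod>i\<in>UNIV. \<beta> i x) * \<gamma> x) l"
proof -
  define r where "r = 1 / (1 - of_nat CARD('k) :: qbar)"
  define C where "C i \<nu> = poch \<psi> (\<alpha> i) \<nu> / poch_circ \<psi> triv_char \<nu>" for i \<nu>
  define M where "M = (mult_chars :: ('k \<Rightarrow> qbar) set)"
  define V where "V = {\<nu> :: 'n \<Rightarrow> 'k \<Rightarrow> qbar. \<forall>i. \<nu> i \<in> M}"
  define \<gamma>' where "\<gamma>' = (\<lambda>x. (\<Prod>i\<in>UNIV. \<beta> i x) * \<gamma> x)"
  define J where "J = jacobi_sum (case_option \<gamma> \<beta>)"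
  have \<gamma>': "\<gamma>' \<in> mult_chars"
    unfolding \<gamma>'_def by (intro mult_mult_chars prod_mult_chars \<beta> \<gamma>(1))
  \<comment> \<open>the Jacobi sums with and without \<open>\<nu>\<close> share the factor \<open>g(\<gamma>)\<close>, which cancels in their quotient\<close>
  have inner: "(\<Sum>x\<in>UNIV. (\<Prod>i\<in>UNIV. \<beta> i (x i) * \<nu> i (x i)) * \<gamma> (1 - (\<Sum>i\<in>UNIV. x i))) =
      (-1) ^ CARD('n) * J * ((\<Prod>i\<in>UNIV. poch \<psi> (\<beta> i) (\<nu> i)) /
        poch_circ \<psi> \<gamma>' (\<lambda>x. \<Prod>i\<in>UNIV. \<nu> i x))"
    if \<nu>: "\<nu> \<in> V" for \<nu>
  proof -
    have \<nu>i: "\<nu> i \<in> mult_chars" for i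
      using \<nu> by (simp add: V_def M_def)
    define \<eta> where "\<eta> = (\<lambda>i x. \<beta> i x * \<nu> i x)"
    have \<eta>: "\<eta> i \<in> mult_chars" for i
      unfolding \<eta>_def by (intro mult_mult_chars \<beta> \<nu>i)
    have J_gauss: "jacobi_sum (case_option \<gamma> \<theta>) *
        gauss_sum_circ \<psi> (\<lambda>x. \<gamma> x * (\<Prod>i\<in>UNIV. \<theta> i x)) =
        gauss_sum \<psi> \<gamma> * (\<Prod>i\<in>UNIV. gauss_sum \<psi> (\<theta> i))"
      if "\<And>i. \<theta> i \<in> mult_chars" for \<theta> :: "'n \<Rightarrow> 'k \<Rightarrow> qbar"
      using jacobi_sum_gauss_sum[OF \<psi>, of "case_option \<gamma> \<theta>" None] that \<gamma>
      by (simp add: prod_UNIV_option split: option.splits)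
    define g where "g = gauss_sum_circ \<psi> \<gamma>'"
    define g\<nu> where "g\<nu> = gauss_sum_circ \<psi> (\<lambda>x. \<gamma>' x * (\<Prod>i\<in>UNIV. \<nu> i x))"
    have "g \<noteq> 0" "g\<nu> \<noteq> 0"
      unfolding g_def g\<nu>_def
      by (intro gauss_sum_circ_nonzero[OF \<psi>] mult_mult_chars prod_mult_chars \<gamma>' \<nu>i)+
    have 1: "J * g = gauss_sum \<psi> \<gamma> * (\<Prod>i\<in>UNIV. gauss_sum \<psi> (\<beta> i))"
      using J_gauss[OF \<beta>] by (simp add: J_def g_def \<gamma>'_def mult.commute)
    have 2: "jacobi_sum (case_option \<gamma> \<eta>) * g\<nu> = gauss_sum \<psi> \<gamma> * (\<Prod>i\<in>UNIV. gauss_sum \<psi> (\<eta> i))"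
      using J_gauss[OF \<eta>] by (simp add: \<eta>_def g\<nu>_def \<gamma>'_def prod.distrib mult_ac)
    have 3: "(\<Prod>i\<in>UNIV. poch \<psi> (\<beta> i) (\<nu> i)) * (\<Prod>i\<in>UNIV. gauss_sum \<psi> (\<beta> i)) =
        (\<Prod>i\<in>UNIV. gauss_sum \<psi> (\<eta> i))"
      using gauss_sum_nonzero[OF \<psi> \<beta>]
      by (simp add: poch_def char_group_simps \<eta>_def prod_dividef)
    have "jacobi_sum (case_option \<gamma> \<eta>) * g\<nu> = J * g * (\<Prod>i\<in>UNIV. poch \<psi> (\<beta> i) (\<nu> i))"
      unfolding 1 2 3[symmetric] by (simp only: mult_ac)
    then have "jacobi_sum (case_option \<gamma> \<eta>) =
        J * ((\<Prod>i\<in>UNIV. poch \<psi> (\<beta> i) (\<nu> i)) / poch_circ \<psi> \<gamma>' (\<lambda>x. \<Prod>i\<in>UNIV. \<nu> i x))"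
      using \<open>g \<noteq> 0\<close> \<open>g\<nu> \<noteq> 0\<close>
      by (simp add: poch_circ_def char_group_simps field_simps flip: g_def g\<nu>_def)
    moreover have "(\<Sum>x\<in>UNIV. (\<Prod>i\<in>UNIV. \<eta> i (x i)) * \<gamma> (1 - (\<Sum>i\<in>UNIV. x i))) =
        (-1) ^ CARD('n) * jacobi_sum (case_option \<gamma> \<eta>)"
      by (simp add: jacobi_sum_case_option[OF \<eta> \<gamma>(1)])
    ultimately show ?thesis
      by (simp add: \<eta>_def mult.assoc)
  qed
  \<comment> \<open>the factor \<open>\<beta> i y\<close> is kept on both sides, because the expansion alone fails at \<open>y = 0\<close>\<close>
  have expand: "inverse (\<alpha> i (1 - l i * y)) * \<beta> i y = r * (\<Sum>\<nu>\<in>M. C i \<nu> * \<nu> (l i) * (\<beta> i y * \<nu> y))" for i y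
  proof (cases "y = 0")
    case False
    then have "inverse (\<alpha> i (1 - l i * y)) = r * (\<Sum>\<nu>\<in>M. C i \<nu> * \<nu> (l i * y))"
      using binomial_theorem_mult_char[OF \<psi> \<alpha>(1) \<alpha>(2), of "l i * y" i] l[of i]
      by (simp add: r_def C_def M_def)
    also have "(\<Sum>\<nu>\<in>M. C i \<nu> * \<nu> (l i * y)) = (\<Sum>\<nu>\<in>M. C i \<nu> * \<nu> (l i) * \<nu> y)"
      by (rule sum.cong) (simp_all add: M_def mult_char_mult)
    finally show ?thesis
      by (simp add: sum_distrib_left sum_distrib_right mult_ac)
  qed (simp add: mult_char_0[OF \<beta>])
  have V_PiE: "V = PiE UNIV (\<lambda>_. M)"
    by (auto simp: V_def)
  have "(\<Sum>x\<in>UNIV. (\<Prod>i\<in>UNIV. inverse (\<alpha> i (1 - l i * x i)) * \<beta> i (x i)) *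
      \<gamma> (1 - (\<Sum>i\<in>UNIV. x i))) =
      (\<Sum>x\<in>UNIV. r ^ CARD('n) * (\<Sum>\<nu>\<in>V. \<Prod>i\<in>UNIV. C i (\<nu> i) * \<nu> i (l i) * (\<beta> i (x i) * \<nu> i (x i))) *
        \<gamma> (1 - (\<Sum>i\<in>UNIV. x i)))"
    unfolding expand prod.distrib[of "\<lambda>_. r"] V_PiE
    by (subst prod_sum_PiE) (simp_all add: M_def finite_mult_chars)
  also have "\<dots> = (\<Sum>x\<in>UNIV. \<Sum>\<nu>\<in>V. r ^ CARD('n) * (\<Prod>i\<in>UNIV. C i (\<nu> i) * \<nu> i (l i)) *
        ((\<Prod>i\<in>UNIV. \<beta> i (x i) * \<nu> i (x i)) * \<gamma> (1 - (\<Sum>i\<in>UNIV. x i))))"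
    by (simp only: prod.distrib sum_distrib_left sum_distrib_right mult.assoc)
  also have "\<dots> = (\<Sum>\<nu>\<in>V. r ^ CARD('n) * (\<Prod>i\<in>UNIV. C i (\<nu> i) * \<nu> i (l i)) *
        (\<Sum>x\<in>UNIV. (\<Prod>i\<in>UNIV. \<beta> i (x i) * \<nu> i (x i)) * \<gamma> (1 - (\<Sum>i\<in>UNIV. x i))))"
    by (subst sum.swap) (simp only: sum_distrib_left)
  also have "\<dots> = (\<Sum>\<nu>\<in>V. (-1) ^ CARD('n) * J * (r ^ CARD('n) *
        (((\<Prod>i\<in>UNIV. poch \<psi> (\<alpha> i) (\<nu> i)) * (\<Prod>i\<in>UNIV. poch \<psi> (\<beta> i) (\<nu> i))) /
        (poch_circ \<psi> \<gamma>' (\<lambda>x. \<Prod>i\<in>UNIV. \<nu> i x) * (\<Prod>i\<in>UNIV. poch_circ \<psi> triv_char (\<nu> i))) *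
        (\<Prod>i\<in>UNIV. \<nu> i (l i)))))"
    by (rule sum.cong, rule refl, subst inner) (simp_all add: C_def prod.distrib prod_dividef mult_ac)
  also have "\<dots> = (-1) ^ CARD('n) * J * lauricella_B \<psi> \<alpha> \<beta> \<gamma>' l"
  proof -
    have "(\<Otimes>\<^bsub>char_group\<^esub>i\<in>UNIV. \<nu> i) = (\<lambda>x. \<Prod>i\<in>UNIV. \<nu> i x)" if "\<nu> \<in> V" for \<nu>
      using that by (intro finprod_char_group) (simp add: V_def M_def)
    moreover have "{\<nu> :: 'n \<Rightarrow> 'k \<Rightarrow> qbar. \<forall>i. \<nu> i \<in> carrier char_group} = V"
      by (simp add: V_def M_def char_group_simps)
    ultimately show ?thesis
      by (simp add: lauricella_B_def char_group_simps(3) r_def power_one_over sum_distrib_left)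
  qed
  finally show ?thesis
    by (simp add: J_def \<gamma>'_def)
qed

section \<open>Counting points\<close>

definition S_B_rhs :: "('n :: finite \<Rightarrow> nat) \<Rightarrow> ('n \<Rightarrow> nat) \<Rightarrow> nat \<Rightarrow> ('n \<Rightarrow> 'k :: {field,finite}) \<Rightarrow>
    ('n \<Rightarrow> 'k) \<Rightarrow> 'k" where
  "S_B_rhs a b c l x = (\<Prod>i\<in>UNIV. (1 - l i * x i) ^ a i) * (\<Prod>i\<in>UNIV. x i ^ b i) *
     (1 - (\<Sum>i\<in>UNIV. x i)) ^ c"

text \<open>The \<open>y\<close>-coordinates of the points counted for \<open>\<xi>\<close> over an \<open>x\<close> at which the right-hand side of the
  equation of the hypersurface is \<open>w\<close>.\<close>
definition twisted_fibre :: "nat \<Rightarrow> 'k :: {field,finite} \<Rightarrow> 'k \<Rightarrow> 'k alg_closure set" where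
  "twisted_fibre d \<xi> w = {y. y ^ d = to_ac w \<and> y ^ CARD('k) = to_ac \<xi> * y}"

text \<open>For \<open>w \<noteq> 0\<close> and \<open>y\<^sup>d = w\<close> the condition \<open>y\<^sup>q = \<xi> y\<close> reads
  \<open>\<xi> = y\<^bsup>q-1\<^esup> = w\<^bsup>(q-1)/d\<^esup>\<close>, which does not depend on \<open>y\<close>: either all \<open>d\<close> roots
  satisfy it or none.\<close>
lemma card_twisted_fibre:
  fixes w \<xi> :: "'k :: {field,finite}"
  assumes d: "d dvd CARD('k) - 1"
  shows "card (twisted_fibre d \<xi> w) =
    (if w = 0 then 1 else if \<xi> = w ^ ((CARD('k) - 1) div d) then d else 0)"
proof -
  have d0: "d > 0"
    using d card_field_gt_1[where 'k = 'k] by (cases d) auto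
  have q: "CARD('k) = Suc (CARD('k) - 1)"
    using card_field_gt_1[where 'k = 'k] by simp
  show ?thesis
  proof (cases "w = 0")
    case True
    have "y ^ d = 0 \<longleftrightarrow> y = 0" for y :: "'k alg_closure"
      using d0 by simp
    then have "twisted_fibre d \<xi> w = {0}"
      by (auto simp: True twisted_fibre_def zero_power)
    then show ?thesis
      using True by simp
  next
    case False
    let ?e = "(CARD('k) - 1) div d"
    have e: "CARD('k) - 1 = d * ?e"
      using d by simp
    have "y ^ CARD('k) = to_ac \<xi> * y \<longleftrightarrow> \<xi> = w ^ ?e" if y: "y ^ d = to_ac w" for y
    proof -
      have "y \<noteq> 0"
        using y False d0 by (auto simp: zero_power)
      have "y ^ CARD('k) = y ^ (d * ?e) * y"
        by (metis q e power_Suc2)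
      also have "y ^ (d * ?e) = to_ac (w ^ ?e)"
        by (simp add: power_mult y)
      finally have "y ^ CARD('k) = to_ac \<xi> * y \<longleftrightarrow> to_ac (w ^ ?e) = to_ac \<xi>"
        by (simp only: mult_right_cancel[OF \<open>y \<noteq> 0\<close>])
      then show ?thesis
        unfolding to_ac_eq_iff by (rule trans) (rule eq_commute)
    qed
    then have "twisted_fibre d \<xi> w = (if \<xi> = w ^ ?e then {y. y ^ d = to_ac w} else {})"
      by (auto simp: twisted_fibre_def)
    moreover have "of_nat d \<noteq> (0 :: 'k alg_closure)"
      using of_nat_dvd_card_minus_1[OF d] by (simp flip: to_ac_of_nat)
    then have "card {y. y ^ d = to_ac w} = d"
      using False by (intro card_nth_roots) simp_all
    ultimately show ?thesis
      using False by simp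
  qed
qed

lemma finite_twisted_fibre:
  assumes "d dvd CARD('k :: {field,finite}) - 1"
  shows "finite (twisted_fibre d \<xi> (w :: 'k))"
proof -
  have "d > 0"
    using assms card_field_gt_1[where 'k = 'k] by (cases d) auto
  from finite_nth_roots[OF this] show ?thesis
    by (rule finite_subset[rotated]) (auto simp: twisted_fibre_def)
qed

text \<open>The group acts on \<open>y\<close> only, so the coordinates \<open>x\<^sub>i\<close> of a point with \<open>F z = \<xi> z\<close> are fixed by
  Frobenius, hence lie in \<open>\<kappa>\<close>, and \<open>y\<close> runs through a twisted fibre over \<open>x\<close>.\<close>
lemma card_twisted_fixed_points:
  fixes l :: "'n :: finite \<Rightarrow> 'k :: {field,finite}"
  assumes d: "d dvd CARD('k) - 1"
  shows "card {z \<in> S_B d a b c l. (frobenius ^^ 1) z = mu_act \<xi> z} =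
    (\<Sum>x\<in>UNIV. card (twisted_fibre d \<xi> (S_B_rhs a b c l x)))"
proof -
  have to_ac_rhs: "to_ac (S_B_rhs a b c l x) = (\<Prod>i\<in>UNIV. (1 - to_ac (l i) * to_ac (x i)) ^ a i) *
      (\<Prod>i\<in>UNIV. to_ac (x i) ^ b i) * (1 - (\<Sum>i\<in>UNIV. to_ac (x i))) ^ c" for x
    by (simp add: S_B_rhs_def to_ac_prod to_ac_sum)
  let ?P = "\<lambda>(x, y). case_option y (\<lambda>i. to_ac (x i :: 'k))"
  let ?D = "SIGMA x:UNIV. twisted_fibre d \<xi> (S_B_rhs a b c l x)"
  have inj: "inj_on ?P ?D"
  proof (rule inj_onI)
    fix p p' :: "('n \<Rightarrow> 'k) \<times> 'k alg_closure"
    assume *: "?P p = ?P p'"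
    show "p = p'"
      using fun_cong[OF *, of None] fun_cong[OF *, of "Some _"]
      by (auto simp: prod_eq_iff fun_eq_iff split: prod.splits)
  qed
  have img: "?P ` ?D = {z \<in> S_B d a b c l. (frobenius ^^ 1) z = mu_act \<xi> z}"
  proof (intro equalityI subsetI)
    fix z
    assume "z \<in> ?P ` ?D"
    then obtain x y where y: "y \<in> twisted_fibre d \<xi> (S_B_rhs a b c l x)"
      and z: "z = case_option y (\<lambda>i. to_ac (x i))"
      by auto
    have "to_ac (x i) ^ CARD('k) = to_ac (x i)" for i
      by (simp only: frobenius_fixed_iff rangeI)
    then show "z \<in> {z \<in> S_B d a b c l. (frobenius ^^ 1) z = mu_act \<xi> z}"
      using y by (simp add: z S_B_def to_ac_rhs twisted_fibre_def frobenius_def mu_act_def fun_eq_iff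
          split: option.splits)
  next
    fix z
    assume "z \<in> {z \<in> S_B d a b c l. (frobenius ^^ 1) z = mu_act \<xi> z}"
    then have z: "z \<in> S_B d a b c l" "z i ^ CARD('k) = mu_act \<xi> z i" for i
      by (auto simp: frobenius_def fun_eq_iff)
    have "z (Some i) \<in> range to_ac" for i
      using z(2)[of "Some i"] by (simp add: mu_act_def flip: frobenius_fixed_iff)
    then obtain x where x: "\<And>i. z (Some i) = to_ac (x i)"
      unfolding image_iff by metis
    have "z None \<in> twisted_fibre d \<xi> (S_B_rhs a b c l x)"
      using z(1) z(2)[of None] by (simp add: twisted_fibre_def S_B_def to_ac_rhs x mu_act_def)
    moreover have "z = case_option (z None) (\<lambda>i. to_ac (x i))"
      by (simp add: fun_eq_iff x split: option.splits)
    ultimately show "z \<in> ?P ` ?D"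
      by (intro image_eqI[of _ _ "(x, z None)"]) auto
  qed
  have "card {z \<in> S_B d a b c l. (frobenius ^^ 1) z = mu_act \<xi> z} = card ?D"
    using card_image[OF inj] unfolding img .
  also have "\<dots> = (\<Sum>x\<in>UNIV. card (twisted_fibre d \<xi> (S_B_rhs a b c l x)))"
    by (intro card_SigmaI) (simp_all add: finite_twisted_fibre[OF d])
  finally show ?thesis .
qed

text \<open>For fixed \<open>x\<close>, let \<open>w\<close> be the value of the right-hand side of the equation. If \<open>w \<noteq> 0\<close>, then only
  \<open>\<xi> = w\<^bsup>(q-1)/d\<^esup>\<close> contributes to the average over \<open>\<mu>\<^sub>d\<close>, and it contributes \<open>\<phi>\<^sub>d\<^sup>m(w)\<close>. If
  \<open>w = 0\<close>, then every \<open>\<xi>\<close> contributes through the single point \<open>y = 0\<close>, and orthogonality on \<open>\<mu>\<^sub>d\<close>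
  gives \<open>1\<close> or \<open>0 = \<phi>\<^sub>d\<^sup>m(0)\<close>, according to whether \<open>d\<close> divides \<open>m\<close>.\<close>
lemma twisted_count_char_sum:
  fixes \<phi> :: "'k :: {field,finite} \<Rightarrow> qbar" and l :: "'n :: finite \<Rightarrow> 'k"
  assumes \<phi>: "\<phi> \<in> mult_chars" and gen: "generate char_group {\<phi>} = mult_chars"
    and d: "d dvd CARD('k) - 1"
  shows "twisted_count (mu d) mu_act 1 (S_B d a b c l) (\<lambda>\<xi>. restrict \<phi> (mu d) \<xi> powi m) =
    (if int d dvd m then of_nat CARD('k) ^ CARD('n)
     else \<Sum>x\<in>UNIV. ((\<phi> [^]\<^bsub>char_group\<^esub> ((CARD('k) - 1) div d)) [^]\<^bsub>char_group\<^esub> m) (S_B_rhs a b c l x))"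
proof -
  let ?e = "(CARD('k) - 1) div d"
  define \<theta> where "\<theta> = (\<phi> [^]\<^bsub>char_group\<^esub> ?e) [^]\<^bsub>char_group\<^esub> m"
  have \<theta>: "\<theta> w = (if w = 0 then 0 else \<phi> (w ^ ?e) powi m)" for w
    using \<phi> by (simp add: \<theta>_def int_pow_char_group nat_pow_mult_chars nat_pow_char_group mult_char_power)
  have d0: "d > 0"
    using d card_field_gt_1[where 'k = 'k] by (cases d) auto
  have fibre_sum: "(\<Sum>\<xi>\<in>mu d. \<phi> \<xi> powi m * of_nat (card (twisted_fibre d \<xi> w))) =
      of_nat d * (if int d dvd m then 1 else \<theta> w)" for w
  proof (cases "w = 0")
    case True
    then show ?thesis
      using generating_char_sum_mu[OF \<phi> gen d, of m]
      by (simp add: card_twisted_fibre[OF d] \<theta>)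
  next
    case False
    have mem: "w ^ ?e \<in> mu d"
      using False d power_card_minus_1[OF False] by (simp add: mu_def flip: power_mult)
    have "(\<Sum>\<xi>\<in>mu d. \<phi> \<xi> powi m * of_nat (card (twisted_fibre d \<xi> w))) =
        (\<Sum>\<xi>\<in>mu d. if \<xi> = w ^ ?e then \<phi> \<xi> powi m * of_nat d else 0)"
      using False by (intro sum.cong) (simp_all add: card_twisted_fibre[OF d])
    also have "\<dots> = \<theta> w * of_nat d"
      using mem False by (simp add: sum.delta \<theta>)
    also have "\<theta> w = (if int d dvd m then 1 else \<theta> w)"
      using False generating_char_pow_eq_triv_iff[OF \<phi> gen d, of m, folded \<theta>_def]
      by (auto simp: triv_char_def)
    finally show ?thesis
      by (simp add: mult.commute)
  qed
  have "twisted_count (mu d) mu_act 1 (S_B d a b c l) (\<lambda>\<xi>. restrict \<phi> (mu d) \<xi> powi m) =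
      1 / of_nat d * (\<Sum>\<xi>\<in>mu d. \<Sum>x\<in>UNIV. \<phi> \<xi> powi m *
        of_nat (card (twisted_fibre d \<xi> (S_B_rhs a b c l x))))"
    unfolding twisted_count_def card_twisted_fixed_points[OF d] card_mu[OF d]
    by (simp add: sum_distrib_left)
  also have "\<dots> = 1 / of_nat d * (\<Sum>x\<in>UNIV. of_nat d *
      (if int d dvd m then 1 else \<theta> (S_B_rhs a b c l x)))"
    by (subst sum.swap) (simp only: fibre_sum)
  also have "\<dots> = (\<Sum>x\<in>UNIV. if int d dvd m then 1 else \<theta> (S_B_rhs a b c l x))"
    using d0 by (simp flip: sum_distrib_left)
  also have "\<dots> = (if int d dvd m then of_nat CARD('k) ^ CARD('n) else \<Sum>x\<in>UNIV. \<theta> (S_B_rhs a b c l x))"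
    by (simp add: card_fun)
  finally show ?thesis
    unfolding \<theta>_def .
qed

text \<open>After the count has become a character sum, it remains to recognise
  \<open>\<theta> = \<phi>\<^sub>d\<^sup>m\<close> of the right-hand side as the integrand with \<open>\<alpha>\<^sub>i = \<theta>\<^bsup>-a\<^sub>i\<^esup>\<close>,
  \<open>\<beta>\<^sub>i = \<theta>\<^bsup>b\<^sub>i\<^esup>\<close> and \<open>\<gamma> = \<theta>\<^sup>c\<close>. Coprimality of \<open>d\<close> with \<open>a\<^sub>i\<close> and \<open>c\<close> keeps \<open>\<alpha>\<^sub>i\<close> and \<open>\<gamma>\<close>
  non-trivial, and positivity of the exponents makes the powers of \<open>\<theta>\<close> vanish at \<open>0\<close>, as characters do.\<close>
theorem theorem4p9:
  fixes \<psi> \<phi> \<phi>\<^sub>d \<chi> :: "'k :: {field,finite} \<Rightarrow> qbar"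
    and d c :: nat and a b :: "'n :: finite \<Rightarrow> nat" and l :: "'n \<Rightarrow> 'k" and m :: int
  assumes "nontriv_add_char \<psi>"
    and "\<phi> \<in> carrier char_group" and "generate char_group {\<phi>} = carrier char_group"
    and "d > 0" and "\<And>i. a i > 0" and "\<And>i. b i > 0" and "c > 0"
    and "d dvd CARD('k) - 1"
    and "\<And>i. l i \<noteq> 0"
    and "\<And>i. gcd d (a i) = 1" and "gcd d c = 1"
    and "\<phi>\<^sub>d = \<phi> [^]\<^bsub>char_group\<^esub> ((CARD('k) - 1) div d)"
    and "\<chi> = restrict \<phi> (mu d)"
  shows "twisted_count (mu d) mu_act 1 (S_B d a b c l) (\<lambda>\<xi>. \<chi> \<xi> powi m) =
    (if int d dvd m then of_nat CARD('k) ^ CARD('n)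
     else (-1) ^ CARD('n) *
       jacobi_sum (\<lambda>i. case i of
           Some i \<Rightarrow> \<phi>\<^sub>d [^]\<^bsub>char_group\<^esub> (m * int (b i))
         | None \<Rightarrow> \<phi>\<^sub>d [^]\<^bsub>char_group\<^esub> (m * int c)) *
       lauricella_B \<psi>
         (\<lambda>i. (inv\<^bsub>char_group\<^esub> \<phi>\<^sub>d) [^]\<^bsub>char_group\<^esub> (m * int (a i)))
         (\<lambda>i. \<phi>\<^sub>d [^]\<^bsub>char_group\<^esub> (m * int (b i)))
         (\<phi>\<^sub>d [^]\<^bsub>char_group\<^esub> (m * int ((\<Sum>i\<in>UNIV. b i) + c)))
         l)"
proof (cases "int d dvd m")
  case True
  then show ?thesis
    using twisted_count_char_sum[of \<phi> d a b c l m] assms by (simp add: char_group_simps)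
next
  case False
  have \<phi>: "\<phi> \<in> mult_chars" and gen: "generate char_group {\<phi>} = mult_chars"
    using assms(2,3) by (simp_all add: char_group_simps)
  have \<phi>\<^sub>d: "\<phi>\<^sub>d \<in> mult_chars"
    using \<phi> by (simp add: assms(12) nat_pow_mult_chars)
  have triv_iff: "\<phi>\<^sub>d [^]\<^bsub>char_group\<^esub> k = triv_char \<longleftrightarrow> int d dvd k" for k :: int
    using generating_char_pow_eq_triv_iff[OF \<phi> gen assms(8)] by (simp add: assms(12))
  have not_dvd: "\<not> int d dvd m * int k" if "gcd d k = 1" for k
    using False that by (metis coprime_dvd_mult_left_iff coprime_iff_gcd_eq_1 coprime_int_iff)
  define \<theta> where "\<theta> = \<phi>\<^sub>d [^]\<^bsub>char_group\<^esub> m"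
  define \<alpha> where "\<alpha> = (\<lambda>i. (inv\<^bsub>char_group\<^esub> \<phi>\<^sub>d) [^]\<^bsub>char_group\<^esub> (m * int (a i)))"
  define \<beta> where "\<beta> = (\<lambda>i. \<phi>\<^sub>d [^]\<^bsub>char_group\<^esub> (m * int (b i)))"
  define \<gamma> where "\<gamma> = \<phi>\<^sub>d [^]\<^bsub>char_group\<^esub> (m * int c)"
  have \<theta>_mem: "\<theta> \<in> mult_chars"
    using \<phi>\<^sub>d by (simp add: \<theta>_def int_pow_mult_chars)
  have pow_\<theta>: "(\<phi>\<^sub>d [^]\<^bsub>char_group\<^esub> (m * int k)) x = \<theta> x ^ k" if "k > 0" for k x
    using that \<phi>\<^sub>d by (simp add: \<theta>_def int_pow_char_group power_int_mult zero_power)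
  have inv_mem: "inv\<^bsub>char_group\<^esub> \<phi>\<^sub>d \<in> mult_chars"
    using \<phi>\<^sub>d by (simp add: inv_char_group inverse_mult_chars)
  have \<alpha>_eq: "\<alpha> i x = inverse (\<theta> x ^ a i)" for i x
  proof -
    have "\<alpha> i x = inverse ((\<phi>\<^sub>d [^]\<^bsub>char_group\<^esub> (m * int (a i))) x)"
      using \<phi>\<^sub>d inv_mem by (simp add: \<alpha>_def int_pow_char_group) (simp add: inv_char_group power_int_inverse)
    then show ?thesis
      using assms(5) by (simp add: pow_\<theta>)
  qed
  have \<alpha>_triv: "\<alpha> i \<noteq> triv_char" for i
  proof
    assume "\<alpha> i = triv_char"
    then have "\<phi>\<^sub>d [^]\<^bsub>char_group\<^esub> (m * int (a i)) = triv_char"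
      using assms(5) by (auto simp: fun_eq_iff \<alpha>_eq pow_\<theta> triv_char_def split: if_splits)
    then show False
      using not_dvd[OF assms(10)] triv_iff by blast
  qed
  have \<gamma>_triv: "\<gamma> \<noteq> triv_char"
    using not_dvd[OF assms(11)] triv_iff by (simp add: \<gamma>_def)
  have \<gamma>': "(\<lambda>x. (\<Prod>i\<in>UNIV. \<beta> i x) * \<gamma> x) = \<phi>\<^sub>d [^]\<^bsub>char_group\<^esub> (m * int ((\<Sum>i\<in>UNIV. b i) + c))"
  proof
    fix x
    show "(\<Prod>i\<in>UNIV. \<beta> i x) * \<gamma> x = (\<phi>\<^sub>d [^]\<^bsub>char_group\<^esub> (m * int ((\<Sum>i\<in>UNIV. b i) + c))) x"
      using assms(6,7) by (subst pow_\<theta>) (simp_all add: \<beta>_def \<gamma>_def pow_\<theta> power_add power_sum)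
  qed
  have \<theta>_rhs: "\<theta> (S_B_rhs a b c l x) =
      (\<Prod>i\<in>UNIV. inverse (\<alpha> i (1 - l i * x i)) * \<beta> i (x i)) * \<gamma> (1 - (\<Sum>i\<in>UNIV. x i))" for x
    using assms(6,7)
    by (simp add: S_B_rhs_def mult_char_mult[OF \<theta>_mem] mult_char_prod[OF \<theta>_mem]
        mult_char_power[OF \<theta>_mem] \<alpha>_eq \<beta>_def \<gamma>_def pow_\<theta> prod.distrib)
  have "twisted_count (mu d) mu_act 1 (S_B d a b c l) (\<lambda>\<xi>. \<chi> \<xi> powi m) =
      (\<Sum>x\<in>UNIV. \<theta> (S_B_rhs a b c l x))"
    using twisted_count_char_sum[OF \<phi> gen assms(8), of a b c l m] False
    by (simp add: assms(12,13) \<theta>_def)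
  also have "\<dots> = (-1) ^ CARD('n) * jacobi_sum (case_option \<gamma> \<beta>) *
      lauricella_B \<psi> \<alpha> \<beta> (\<lambda>x. (\<Prod>i\<in>UNIV. \<beta> i x) * \<gamma> x) l"
    unfolding \<theta>_rhs
    by (rule lauricella_B_integral_representation)
      (use assms(1,9) \<alpha>_triv \<gamma>_triv \<phi>\<^sub>d inv_mem in
        \<open>auto simp: \<alpha>_def \<beta>_def \<gamma>_def int_pow_mult_chars\<close>)
  finally show ?thesis
    unfolding \<gamma>' using False by (simp only: \<alpha>_def \<beta>_def \<gamma>_def if_False)
qed

end
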